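(* Let $H$ be a Hopf algebra over a field $\Bbbk$ whose antipode $S$ satisfies $S^2=\mathrm{id}$, and assume that $M,N\in\mathcal{LR}(H)$ satisfy the $u$-condition. Then $M\otimes N$ satisfies the $u$-condition if and only if $\psi_{M,N}$ is a symmetry, i.e. $\psi_{N,M}\circ\psi_{M,N}=\mathrm{id}_{M\otimes N}$.
   Context: Everything is over a field $\Bbbk$; Sweedler notation $\Delta(h)=h_1\otimes h_2$ is used with summation omitted. A Yetter-Drinfel'd-Long bimodule over a Hopf algebra $H$ is a vector space $M$ which is an $H$-bimodule (left action $h\otimes m\mapsto h\triangleright m$, right action $m\otimes h\mapsto m\triangleleft h$, with $(a\triangleright m)\triangleleft b=a\triangleright(m\triangleleft b)$) and an $H$-bicomodule (left coaction $m\mapsto m_{[-1]}\otimes m_{[0]}\in H\otimes M$, right coaction $m\mapsto m_{(0)}\otimes m_{(1)}\in M\otimes H$, with $m_{[-1]}\otimes m_{[0](0)}\otimes m_{[0](1)}=m_{(0)[-1]}\otimes m_{(0)[0]}\otimes m_{(1)}$), such that for all $h\in H$, $m\in M$: $(h_1\triangleright m)_{[-1]}h_2\otimes(h_1\triangleright m)_{[0]}=h_1m_{[-1]}\otimes h_2\triangleright m_{[0]}$; $(h\triangleright m)_{(0)}\otimes(h\triangleright m)_{(1)}=h\triangleright m_{(0)}\otimes m_{(1)}$; $(m\triangleleft h_2)_{(0)}\otimes h_1(m\triangleleft h_2)_{(1)}=m_{(0)}\triangleleft h_1\otimes m_{(1)}h_2$; $(m\triangleleft h)_{[-1]}\otimes(m\triangleleft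 h)_{[0]}=m_{[-1]}\otimes m_{[0]}\triangleleft h$. $\mathcal{LR}(H)$ is the category of Yetter-Drinfel'd-Long bimodules over $H$, with morphisms the $H$-bilinear and $H$-bicolinear maps. If the antipode of $H$ is bijective it is a (strict) braided monoidal category with $h\triangleright(m\otimes n)=h_1\triangleright m\otimes h_2\triangleright n$, $(m\otimes n)\triangleleft h=m\triangleleft h_1\otimes n\triangleleft h_2$, $(m\otimes n)_{[-1]}\otimes(m\otimes n)_{[0]}=m_{[-1]}n_{[-1]}\otimes m_{[0]}\otimes n_{[0]}$, $(m\otimes n)_{(0)}\otimes(m\otimes n)_{(1)}=m_{(0)}\otimes n_{(0)}\otimes m_{(1)}n_{(1)}$, and braiding $\psi_{M,N}:M\otimes N\to N\otimes M$, $\psi_{M,N}(m\otimes n)=m_{[-1]}\triangleright n_{(0)}\otimes m_{[0]}\triangleleft n_{(1)}$. An object $M\in\mathcal{LR}(H)$ satisfies the $u$-condition if $m_{[-1]}\triangleright m_{[0](0)}\triangleleft m_{[0](1)}=m$ for all $m\in M$. *)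

theory Defs
  imports "HOL-Algebra.Module" "HOL-Algebra.AbelCoset"
begin

section \<open>Linear maps and tensor products of vector spaces\<close>

text \<open>
  Vector spaces over \<open>K\<close> are structures \<open>V\<close> with \<open>module K V\<close>, where \<open>K\<close> is a field.  The components
  \<open>mult\<close> and \<open>one\<close> of the record type \<open>module\<close> play no role for a mere vector space; the
  constructions below leave them unspecified.
\<close>

definition linear_map ::
  "('k, 'c) ring_scheme \<Rightarrow> ('k, 'v, 'x) module_scheme \<Rightarrow> ('k, 'w, 'y) module_scheme \<Rightarrow> ('v \<Rightarrow> 'w) \<Rightarrow> bool"
  where "linear_map K V W f \<longleftrightarrow>
    f \<in> carrier V \<rightarrow> carrier W \<and>
    (\<forall>v \<in> carrier V. \<forall>v' \<in> carrier V. f (v \<oplus>\<^bsub>V\<^esub> v') = f v \<oplus>\<^bsub>W\<^esub> f v') \<and>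
    (\<forall>a \<in> carrier K. \<forall>v \<in> carrier V. f (a \<odot>\<^bsub>V\<^esub> v) = a \<odot>\<^bsub>W\<^esub> f v)"

definition bilinear_map ::
  "('k, 'c) ring_scheme \<Rightarrow> ('k, 'u, 'x) module_scheme \<Rightarrow> ('k, 'v, 'y) module_scheme \<Rightarrow>
   ('k, 'w, 'z) module_scheme \<Rightarrow> ('u \<Rightarrow> 'v \<Rightarrow> 'w) \<Rightarrow> bool"
  where "bilinear_map K U V W b \<longleftrightarrow>
    (\<forall>u \<in> carrier U. linear_map K V W (b u)) \<and>
    (\<forall>v \<in> carrier V. linear_map K U W (\<lambda>u. b u v))"

definition free_module :: "('k, 'c) ring_scheme \<Rightarrow> 'x set \<Rightarrow> ('k, 'x \<Rightarrow> 'k) module"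
  where "free_module K X =
    \<lparr>carrier = {p. range p \<subseteq> carrier K \<and> finite {x. p x \<noteq> \<zero>\<^bsub>K\<^esub>} \<and> {x. p x \<noteq> \<zero>\<^bsub>K\<^esub>} \<subseteq> X},
     mult = undefined, one = undefined,
     zero = (\<lambda>_. \<zero>\<^bsub>K\<^esub>), add = (\<lambda>p q x. p x \<oplus>\<^bsub>K\<^esub> q x),
     smult = (\<lambda>a p x. a \<otimes>\<^bsub>K\<^esub> p x)\<rparr>"

definition generated_submodule ::
  "('k, 'c) ring_scheme \<Rightarrow> ('k, 'm, 'z) module_scheme \<Rightarrow> 'm set \<Rightarrow> 'm set"
  where "generated_submodule K M S = \<Inter>{N. submodule N K M \<and> S \<subseteq> N}"

definition quotient_module :: "('k, 'm, 'z) module_scheme \<Rightarrow> 'm set \<Rightarrow> ('k, 'm set) module"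
  where "quotient_module M N =
    \<lparr>carrier = a_rcosets\<^bsub>M\<^esub> N,
     mult = undefined, one = undefined,
     zero = N, add = set_add M,
     smult = (\<lambda>a X. N <+>\<^bsub>M\<^esub> ((\<lambda>x. a \<odot>\<^bsub>M\<^esub> x) ` X))\<rparr>"

definition single :: "('k, 'c) ring_scheme \<Rightarrow> 'x \<Rightarrow> 'x \<Rightarrow> 'k"
  where "single K x = (\<lambda>y. if y = x then \<one>\<^bsub>K\<^esub> else \<zero>\<^bsub>K\<^esub>)"

definition tensor_relations ::
  "('k, 'c) ring_scheme \<Rightarrow> ('k, 'v, 'x) module_scheme \<Rightarrow> ('k, 'w, 'y) module_scheme \<Rightarrow> ('v \<times> 'w \<Rightarrow> 'k) set"
  where "tensor_relations K V W =
    (let F = free_module K (carrier V \<times> carrier W) in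
      {single K (v \<oplus>\<^bsub>V\<^esub> v', w) \<ominus>\<^bsub>F\<^esub> (single K (v, w) \<oplus>\<^bsub>F\<^esub> single K (v', w)) | v v' w.
         v \<in> carrier V \<and> v' \<in> carrier V \<and> w \<in> carrier W} \<union>
      {single K (v, w \<oplus>\<^bsub>W\<^esub> w') \<ominus>\<^bsub>F\<^esub> (single K (v, w) \<oplus>\<^bsub>F\<^esub> single K (v, w')) | v w w'.
         v \<in> carrier V \<and> w \<in> carrier W \<and> w' \<in> carrier W} \<union>
      {single K (a \<odot>\<^bsub>V\<^esub> v, w) \<ominus>\<^bsub>F\<^esub> (a \<odot>\<^bsub>F\<^esub> single K (v, w)) | a v w.
         a \<in> carrier K \<and> v \<in> carrier V \<and> w \<in> carrier W} \<union>
      {single K (v, a \<odot>\<^bsub>W\<^esub> w) \<ominus>\<^bsub>F\<^esub> (a \<odot>\<^bsub>F\<^esub> single K (v, w)) | a v w.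
         a \<in> carrier K \<and> v \<in> carrier V \<and> w \<in> carrier W})"

definition tensor_null ::
  "('k, 'c) ring_scheme \<Rightarrow> ('k, 'v, 'x) module_scheme \<Rightarrow> ('k, 'w, 'y) module_scheme \<Rightarrow> ('v \<times> 'w \<Rightarrow> 'k) set"
  where "tensor_null K V W =
    generated_submodule K (free_module K (carrier V \<times> carrier W)) (tensor_relations K V W)"

definition tensor ::
  "('k, 'c) ring_scheme \<Rightarrow> ('k, 'v, 'x) module_scheme \<Rightarrow> ('k, 'w, 'y) module_scheme \<Rightarrow>
   ('k, ('v \<times> 'w \<Rightarrow> 'k) set) module"  (infixr \<open>\<boxtimes>\<index>\<close> 65)
  where "V \<boxtimes>\<^bsub>K\<^esub> W =
    quotient_module (free_module K (carrier V \<times> carrier W)) (tensor_null K V W)"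

definition ptensor ::
  "('k, 'c) ring_scheme \<Rightarrow> ('k, 'v, 'x) module_scheme \<Rightarrow> ('k, 'w, 'y) module_scheme \<Rightarrow>
   'v \<Rightarrow> 'w \<Rightarrow> ('v \<times> 'w \<Rightarrow> 'k) set"
  where "ptensor K V W v w =
    tensor_null K V W +>\<^bsub>free_module K (carrier V \<times> carrier W)\<^esub> single K (v, w)"

text \<open>
  \<open>sweedler K P t b\<close> is the image of the tensor \<open>t\<close> under the linear map into \<open>P\<close> induced by the
  bilinear map \<open>b\<close>: if \<open>t\<close> is the sum of the \<open>v\<^sub>i \<otimes> w\<^sub>i\<close>, it is the sum in \<open>P\<close> of the \<open>b v\<^sub>i w\<^sub>i\<close>.  For
  bilinear \<open>b\<close> the value does not depend on the chosen representative \<open>p\<close> of \<open>t\<close>.  With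
  \<open>t = \<Delta>(h)\<close>, the term \<open>sweedler K P t (\<lambda>h\<^sub>1 h\<^sub>2. \<dots>)\<close> is the Sweedler expression written as
  \<open>\<dots>\<close> with the summation omitted.
\<close>

definition sweedler ::
  "('k, 'c) ring_scheme \<Rightarrow> ('k, 'p, 'z) module_scheme \<Rightarrow> ('v \<times> 'w \<Rightarrow> 'k) set \<Rightarrow> ('v \<Rightarrow> 'w \<Rightarrow> 'p) \<Rightarrow> 'p"
  where "sweedler K P t b =
    (let p = (SOME p. p \<in> t) in
      \<Oplus>\<^bsub>P\<^esub>z \<in> {z. p z \<noteq> \<zero>\<^bsub>K\<^esub>}. p z \<odot>\<^bsub>P\<^esub> b (fst z) (snd z))"


section \<open>Hopf algebras\<close>

record ('k, 'h) hopf = "('k, 'h) module" +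
  comult :: "'h \<Rightarrow> ('h \<times> 'h \<Rightarrow> 'k) set"
  counit :: "'h \<Rightarrow> 'k"
  antipode :: "'h \<Rightarrow> 'h"

text \<open>Iterated tensor products are bracketed to the right.\<close>

locale hopf_algebra = K?: field K + H?: ring H + HM?: module K H
  for K (structure) and H :: "('k, 'h, 'z) hopf_scheme" +
  assumes mult_bilinear: "bilinear_map K H H H (mult H)"
    and comult_linear: "linear_map K H (H \<boxtimes> H) (comult H)"
    and counit_scalar: "\<And>a h. a \<in> carrier K \<Longrightarrow> h \<in> carrier H \<Longrightarrow>
      counit H (a \<odot>\<^bsub>H\<^esub> h) = a \<otimes> counit H h"
    and coassoc: "\<And>h. h \<in> carrier H \<Longrightarrow>
      sweedler K (H \<boxtimes> (H \<boxtimes> H)) (comult H h) (\<lambda>h1 h2.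
        sweedler K (H \<boxtimes> (H \<boxtimes> H)) (comult H h1) (\<lambda>x y.
          ptensor K H (H \<boxtimes> H) x (ptensor K H H y h2))) =
      sweedler K (H \<boxtimes> (H \<boxtimes> H)) (comult H h) (\<lambda>h1 h2.
        ptensor K H (H \<boxtimes> H) h1 (comult H h2))"
    and counit_left: "\<And>h. h \<in> carrier H \<Longrightarrow>
      sweedler K H (comult H h) (\<lambda>h1 h2. counit H h1 \<odot>\<^bsub>H\<^esub> h2) = h"
    and counit_right: "\<And>h. h \<in> carrier H \<Longrightarrow>
      sweedler K H (comult H h) (\<lambda>h1 h2. counit H h2 \<odot>\<^bsub>H\<^esub> h1) = h"
    and comult_mult: "\<And>g h. g \<in> carrier H \<Longrightarrow> h \<in> carrier H \<Longrightarrow>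
      comult H (g \<otimes>\<^bsub>H\<^esub> h) =
      sweedler K (H \<boxtimes> H) (comult H g) (\<lambda>g1 g2.
        sweedler K (H \<boxtimes> H) (comult H h) (\<lambda>h1 h2.
          ptensor K H H (g1 \<otimes>\<^bsub>H\<^esub> h1) (g2 \<otimes>\<^bsub>H\<^esub> h2)))"
    and comult_one: "comult H \<one>\<^bsub>H\<^esub> = ptensor K H H \<one>\<^bsub>H\<^esub> \<one>\<^bsub>H\<^esub>"
    and counit_ring_hom: "counit H \<in> ring_hom H K"
    and antipode_linear: "linear_map K H H (antipode H)"
    and antipode_left: "\<And>h. h \<in> carrier H \<Longrightarrow>
      sweedler K H (comult H h) (\<lambda>h1 h2. antipode H h1 \<otimes>\<^bsub>H\<^esub> h2) = counit H h \<odot>\<^bsub>H\<^esub> \<one>\<^bsub>H\<^esub>"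
    and antipode_right: "\<And>h. h \<in> carrier H \<Longrightarrow>
      sweedler K H (comult H h) (\<lambda>h1 h2. h1 \<otimes>\<^bsub>H\<^esub> antipode H h2) = counit H h \<odot>\<^bsub>H\<^esub> \<one>\<^bsub>H\<^esub>"


section \<open>Yetter-Drinfel'd-Long bimodules\<close>

record ('k, 'h, 'm) ydl = "('k, 'm) module" +
  lact :: "'h \<Rightarrow> 'm \<Rightarrow> 'm"  (infixr \<open>\<triangleright>\<index>\<close> 75)
  ract :: "'m \<Rightarrow> 'h \<Rightarrow> 'm"  (infixl \<open>\<triangleleft>\<index>\<close> 74)
  lcoact :: "'m \<Rightarrow> ('h \<times> 'm \<Rightarrow> 'k) set"
  rcoact :: "'m \<Rightarrow> ('m \<times> 'h \<Rightarrow> 'k) set"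

locale h_bimodule = hopf_algebra K H + M: module K M
  for K (structure) and H :: "('k, 'h, 'z) hopf_scheme" and M :: "('k, 'h, 'm, 'y) ydl_scheme" +
  assumes lact_bilinear: "bilinear_map K H M M (lact M)"
    and lact_one: "\<And>m. m \<in> carrier M \<Longrightarrow> \<one>\<^bsub>H\<^esub> \<triangleright>\<^bsub>M\<^esub> m = m"
    and lact_mult: "\<And>a b m. a \<in> carrier H \<Longrightarrow> b \<in> carrier H \<Longrightarrow> m \<in> carrier M \<Longrightarrow>
      (a \<otimes>\<^bsub>H\<^esub> b) \<triangleright>\<^bsub>M\<^esub> m = a \<triangleright>\<^bsub>M\<^esub> (b \<triangleright>\<^bsub>M\<^esub> m)"
    and ract_bilinear: "bilinear_map K M H M (ract M)"
    and ract_one: "\<And>m. m \<in> carrier M \<Longrightarrow> m \<triangleleft>\<^bsub>M\<^esub> \<one>\<^bsub>H\<^esub> = m"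
    and ract_mult: "\<And>a b m. a \<in> carrier H \<Longrightarrow> b \<in> carrier H \<Longrightarrow> m \<in> carrier M \<Longrightarrow>
      m \<triangleleft>\<^bsub>M\<^esub> (a \<otimes>\<^bsub>H\<^esub> b) = (m \<triangleleft>\<^bsub>M\<^esub> a) \<triangleleft>\<^bsub>M\<^esub> b"
    and lact_ract: "\<And>a b m. a \<in> carrier H \<Longrightarrow> b \<in> carrier H \<Longrightarrow> m \<in> carrier M \<Longrightarrow>
      (a \<triangleright>\<^bsub>M\<^esub> m) \<triangleleft>\<^bsub>M\<^esub> b = a \<triangleright>\<^bsub>M\<^esub> (m \<triangleleft>\<^bsub>M\<^esub> b)"

locale h_bicomodule = hopf_algebra K H + M: module K M
  for K (structure) and H :: "('k, 'h, 'z) hopf_scheme" and M :: "('k, 'h, 'm, 'y) ydl_scheme" +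
  assumes lcoact_linear: "linear_map K M (H \<boxtimes> M) (lcoact M)"
    and lcoact_coassoc: "\<And>m. m \<in> carrier M \<Longrightarrow>
      sweedler K (H \<boxtimes> (H \<boxtimes> M)) (lcoact M m) (\<lambda>x m0.
        sweedler K (H \<boxtimes> (H \<boxtimes> M)) (comult H x) (\<lambda>x1 x2.
          ptensor K H (H \<boxtimes> M) x1 (ptensor K H M x2 m0))) =
      sweedler K (H \<boxtimes> (H \<boxtimes> M)) (lcoact M m) (\<lambda>x m0.
        ptensor K H (H \<boxtimes> M) x (lcoact M m0))"
    and lcoact_counit: "\<And>m. m \<in> carrier M \<Longrightarrow>
      sweedler K M (lcoact M m) (\<lambda>x m0. counit H x \<odot>\<^bsub>M\<^esub> m0) = m"
    and rcoact_linear: "linear_map K M (M \<boxtimes> H) (rcoact M)"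
    and rcoact_coassoc: "\<And>m. m \<in> carrier M \<Longrightarrow>
      sweedler K (M \<boxtimes> (H \<boxtimes> H)) (rcoact M m) (\<lambda>m0 x.
        sweedler K (M \<boxtimes> (H \<boxtimes> H)) (rcoact M m0) (\<lambda>m00 y.
          ptensor K M (H \<boxtimes> H) m00 (ptensor K H H y x))) =
      sweedler K (M \<boxtimes> (H \<boxtimes> H)) (rcoact M m) (\<lambda>m0 x.
        ptensor K M (H \<boxtimes> H) m0 (comult H x))"
    and rcoact_counit: "\<And>m. m \<in> carrier M \<Longrightarrow>
      sweedler K M (rcoact M m) (\<lambda>m0 x. counit H x \<odot>\<^bsub>M\<^esub> m0) = m"
    and lcoact_rcoact: "\<And>m. m \<in> carrier M \<Longrightarrow>
      sweedler K (H \<boxtimes> (M \<boxtimes> H)) (lcoact M m) (\<lambda>x m0.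
        ptensor K H (M \<boxtimes> H) x (rcoact M m0)) =
      sweedler K (H \<boxtimes> (M \<boxtimes> H)) (rcoact M m) (\<lambda>m0 y.
        sweedler K (H \<boxtimes> (M \<boxtimes> H)) (lcoact M m0) (\<lambda>x m00.
          ptensor K H (M \<boxtimes> H) x (ptensor K M H m00 y)))"

locale yd_long_bimodule = h_bimodule K H M + h_bicomodule K H M
  for K (structure) and H :: "('k, 'h, 'z) hopf_scheme" and M :: "('k, 'h, 'm, 'y) ydl_scheme" +
  assumes lact_lcoact: "\<And>h m. h \<in> carrier H \<Longrightarrow> m \<in> carrier M \<Longrightarrow>
      sweedler K (H \<boxtimes> M) (comult H h) (\<lambda>h1 h2.
        sweedler K (H \<boxtimes> M) (lcoact M (h1 \<triangleright>\<^bsub>M\<^esub> m)) (\<lambda>x m0.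
          ptensor K H M (x \<otimes>\<^bsub>H\<^esub> h2) m0)) =
      sweedler K (H \<boxtimes> M) (comult H h) (\<lambda>h1 h2.
        sweedler K (H \<boxtimes> M) (lcoact M m) (\<lambda>x m0.
          ptensor K H M (h1 \<otimes>\<^bsub>H\<^esub> x) (h2 \<triangleright>\<^bsub>M\<^esub> m0)))"
    and lact_rcoact: "\<And>h m. h \<in> carrier H \<Longrightarrow> m \<in> carrier M \<Longrightarrow>
      rcoact M (h \<triangleright>\<^bsub>M\<^esub> m) =
      sweedler K (M \<boxtimes> H) (rcoact M m) (\<lambda>m0 x. ptensor K M H (h \<triangleright>\<^bsub>M\<^esub> m0) x)"
    and ract_rcoact: "\<And>h m. h \<in> carrier H \<Longrightarrow> m \<in> carrier M \<Longrightarrow>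
      sweedler K (M \<boxtimes> H) (comult H h) (\<lambda>h1 h2.
        sweedler K (M \<boxtimes> H) (rcoact M (m \<triangleleft>\<^bsub>M\<^esub> h2)) (\<lambda>m0 x.
          ptensor K M H m0 (h1 \<otimes>\<^bsub>H\<^esub> x))) =
      sweedler K (M \<boxtimes> H) (comult H h) (\<lambda>h1 h2.
        sweedler K (M \<boxtimes> H) (rcoact M m) (\<lambda>m0 x.
          ptensor K M H (m0 \<triangleleft>\<^bsub>M\<^esub> h1) (x \<otimes>\<^bsub>H\<^esub> h2)))"
    and ract_lcoact: "\<And>h m. h \<in> carrier H \<Longrightarrow> m \<in> carrier M \<Longrightarrow>
      lcoact M (m \<triangleleft>\<^bsub>M\<^esub> h) =
      sweedler K (H \<boxtimes> M) (lcoact M m) (\<lambda>x m0. ptensor K H M x (m0 \<triangleleft>\<^bsub>M\<^esub> h))"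

definition ydl_tensor ::
  "('k, 'c) ring_scheme \<Rightarrow> ('k, 'h, 'z) hopf_scheme \<Rightarrow>
   ('k, 'h, 'm, 'x) ydl_scheme \<Rightarrow> ('k, 'h, 'n, 'y) ydl_scheme \<Rightarrow> ('k, 'h, ('m \<times> 'n \<Rightarrow> 'k) set) ydl"
  where "ydl_tensor K H M N = (let T = M \<boxtimes>\<^bsub>K\<^esub> N in
    \<lparr>carrier = carrier T, mult = mult T, one = one T, zero = zero T, add = add T, smult = smult T,
     lact = (\<lambda>h t.
       sweedler K T (comult H h) (\<lambda>h1 h2.
         sweedler K T t (\<lambda>m n. ptensor K M N (h1 \<triangleright>\<^bsub>M\<^esub> m) (h2 \<triangleright>\<^bsub>N\<^esub> n)))),
     ract = (\<lambda>t h.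
       sweedler K T (comult H h) (\<lambda>h1 h2.
         sweedler K T t (\<lambda>m n. ptensor K M N (m \<triangleleft>\<^bsub>M\<^esub> h1) (n \<triangleleft>\<^bsub>N\<^esub> h2)))),
     lcoact = (\<lambda>t.
       sweedler K (H \<boxtimes>\<^bsub>K\<^esub> T) t (\<lambda>m n.
         sweedler K (H \<boxtimes>\<^bsub>K\<^esub> T) (lcoact M m) (\<lambda>x m0.
           sweedler K (H \<boxtimes>\<^bsub>K\<^esub> T) (lcoact N n) (\<lambda>y n0.
             ptensor K H T (x \<otimes>\<^bsub>H\<^esub> y) (ptensor K M N m0 n0))))),
     rcoact = (\<lambda>t.
       sweedler K (T \<boxtimes>\<^bsub>K\<^esub> H) t (\<lambda>m n.
         sweedler K (T \<boxtimes>\<^bsub>K\<^esub> H) (rcoact M m) (\<lambda>m0 x.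
           sweedler K (T \<boxtimes>\<^bsub>K\<^esub> H) (rcoact N n) (\<lambda>n0 y.
             ptensor K T H (ptensor K M N m0 n0) (x \<otimes>\<^bsub>H\<^esub> y)))))\<rparr>)"

definition braiding ::
  "('k, 'c) ring_scheme \<Rightarrow> ('k, 'h, 'm, 'x) ydl_scheme \<Rightarrow> ('k, 'h, 'n, 'y) ydl_scheme \<Rightarrow>
   ('m \<times> 'n \<Rightarrow> 'k) set \<Rightarrow> ('n \<times> 'm \<Rightarrow> 'k) set"
  where "braiding K M N t =
    sweedler K (N \<boxtimes>\<^bsub>K\<^esub> M) t (\<lambda>m n.
      sweedler K (N \<boxtimes>\<^bsub>K\<^esub> M) (lcoact M m) (\<lambda>x m0.
        sweedler K (N \<boxtimes>\<^bsub>K\<^esub> M) (rcoact N n) (\<lambda>n0 y.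
          ptensor K N M (x \<triangleright>\<^bsub>N\<^esub> n0) (m0 \<triangleleft>\<^bsub>M\<^esub> y))))"

definition u_condition :: "('k, 'c) ring_scheme \<Rightarrow> ('k, 'h, 'm, 'x) ydl_scheme \<Rightarrow> bool"
  where "u_condition K M \<longleftrightarrow>
    (\<forall>m \<in> carrier M.
      sweedler K M (lcoact M m) (\<lambda>x m0.
        sweedler K M (rcoact M m0) (\<lambda>m00 y. (x \<triangleright>\<^bsub>M\<^esub> m00) \<triangleleft>\<^bsub>M\<^esub> y)) = m)"

end

theory Submission
  imports Defs
begin

text \<open>
  For bimodules that satisfy the \<open>u\<close>-condition, the squared braiding \<open>\<psi>\<^sub>N\<^sub>,\<^sub>M \<circ> \<psi>\<^sub>M\<^sub>,\<^sub>N\<close> is equal to the map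
  \<open>t \<mapsto> t\<^sub>[\<^sub>-\<^sub>1\<^sub>] \<triangleright> t\<^sub>[\<^sub>0\<^sub>]\<^sub>(\<^sub>0\<^sub>) \<triangleleft> t\<^sub>[\<^sub>0\<^sub>]\<^sub>(\<^sub>1\<^sub>)\<close> of the \<open>u\<close>-condition for \<open>M \<otimes> N\<close> (\<open>u_map_eq_braiding_braiding\<close>).  So one
  of them is the identity if and only if the other one is.

  To prove this equality, the map of the \<open>u\<close>-condition is factored into two halves, the twists
  \<open>m \<mapsto> m\<^sub>[\<^sub>-\<^sub>1\<^sub>] \<triangleright> m\<^sub>[\<^sub>0\<^sub>]\<close> and \<open>m \<mapsto> m\<^sub>(\<^sub>0\<^sub>) \<triangleleft> m\<^sub>(\<^sub>1\<^sub>)\<close>.  The first is always right colinear and the second is always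
  left colinear.  Under the \<open>u\<close>-condition they are inverse to each other, hence both are colinear on
  both sides.  By coassociativity, a component of \<open>m\<close> that acts on another component of \<open>m\<close> can then
  be removed, at the price of replacing \<open>m\<close> by its image under a twist (\<open>lsum_absorb\<close>,
  \<open>rsum_absorb\<close>).

  With \<open>X = m\<^sub>(\<^sub>0\<^sub>) \<triangleleft> m\<^sub>(\<^sub>1\<^sub>)\<close> and \<open>Y = n\<^sub>[\<^sub>-\<^sub>1\<^sub>] \<triangleright> n\<^sub>[\<^sub>0\<^sub>]\<close>, the map of the \<open>u\<close>-condition takes \<open>m \<otimes> n\<close> to an expression in the
  components of \<open>X\<close> and \<open>Y\<close>.  The left compatibility condition of \<open>N\<close> and the right one of \<open>M\<close> reorder
  this expression so that the inner components of \<open>X\<close> and \<open>Y\<close> can be absorbed again.  This turns \<open>X\<close>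
  back into \<open>m\<close> and \<open>Y\<close> back into \<open>n\<close>, and leaves the squared braiding (\<open>u_expression_eq_braidings\<close>).

  The Sweedler notation is justified by the universal property of the tensor product: an identity
  between tensors may be used with an arbitrary multilinear expression in the components.
\<close>

section \<open>Linear maps\<close>

lemma linear_mapI:
  assumes "\<And>v. v \<in> carrier V \<Longrightarrow> f v \<in> carrier W"
    and "\<And>v v'. v \<in> carrier V \<Longrightarrow> v' \<in> carrier V \<Longrightarrow> f (v \<oplus>\<^bsub>V\<^esub> v') = f v \<oplus>\<^bsub>W\<^esub> f v'"
    and "\<And>a v. a \<in> carrier K \<Longrightarrow> v \<in> carrier V \<Longrightarrow> f (a \<odot>\<^bsub>V\<^esub> v) = a \<odot>\<^bsub>W\<^esub> f v"
  shows "linear_map K V W f"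
  using assms by (auto simp: linear_map_def)

lemma linear_mapD:
  assumes "linear_map K V W f"
  shows linear_map_closed: "v \<in> carrier V \<Longrightarrow> f v \<in> carrier W"
    and linear_map_add: "v \<in> carrier V \<Longrightarrow> v' \<in> carrier V \<Longrightarrow> f (v \<oplus>\<^bsub>V\<^esub> v') = f v \<oplus>\<^bsub>W\<^esub> f v'"
    and linear_map_smult: "a \<in> carrier K \<Longrightarrow> v \<in> carrier V \<Longrightarrow> f (a \<odot>\<^bsub>V\<^esub> v) = a \<odot>\<^bsub>W\<^esub> f v"
  using assms by (auto simp: linear_map_def)

lemma bilinear_mapI:
  assumes "\<And>u. u \<in> carrier U \<Longrightarrow> linear_map K V W (\<lambda>v. b u v)"
    and "\<And>v. v \<in> carrier V \<Longrightarrow> linear_map K U W (\<lambda>u. b u v)"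
  shows "bilinear_map K U V W b"
  using assms by (auto simp: bilinear_map_def)

lemma
  assumes "bilinear_map K U V W b"
  shows bilinear_map_right: "u \<in> carrier U \<Longrightarrow> linear_map K V W (\<lambda>v. b u v)"
    and bilinear_map_left: "v \<in> carrier V \<Longrightarrow> linear_map K U W (\<lambda>u. b u v)"
    and bilinear_map_closed: "u \<in> carrier U \<Longrightarrow> v \<in> carrier V \<Longrightarrow> b u v \<in> carrier W"
  using assms by (auto simp: bilinear_map_def linear_map_def)

lemma linear_map_id: "linear_map K V V (\<lambda>v. v)"
  by (rule linear_mapI) auto

lemma linear_map_comp:
  "linear_map K V W f \<Longrightarrow> linear_map K U V g \<Longrightarrow> linear_map K U W (\<lambda>u. f (g u))"
  by (auto simp: linear_map_def Pi_iff)

lemma linear_map_zero: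
  assumes "module K V" "module K W" "linear_map K V W f"
  shows "f \<zero>\<^bsub>V\<^esub> = \<zero>\<^bsub>W\<^esub>"
proof -
  interpret V: module K V by fact
  interpret W: module K W by fact
  have "f (\<zero>\<^bsub>K\<^esub> \<odot>\<^bsub>V\<^esub> \<zero>\<^bsub>V\<^esub>) = \<zero>\<^bsub>K\<^esub> \<odot>\<^bsub>W\<^esub> f \<zero>\<^bsub>V\<^esub>"
    by (rule linear_map_smult[OF assms(3)]) auto
  then show ?thesis using linear_map_closed[OF assms(3)] by simp
qed

lemma linear_map_minus:
  assumes "module K V" "module K W" "linear_map K V W f" "v \<in> carrier V" "v' \<in> carrier V"
  shows "f (v \<ominus>\<^bsub>V\<^esub> v') = f v \<ominus>\<^bsub>W\<^esub> f v'"
proof -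
  interpret V: module K V by fact
  interpret W: module K W by fact
  have "f (v \<ominus>\<^bsub>V\<^esub> v') \<oplus>\<^bsub>W\<^esub> f v' = f v"
    using assms(4,5) by (simp add: linear_map_add[OF assms(3), symmetric] V.minus_eq V.add.m_assoc V.l_neg)
  then show ?thesis
    using assms linear_map_closed[OF assms(3)]
    by (metis V.minus_closed W.add.inv_solve_right W.minus_eq)
qed

lemma linear_map_finsum:
  assumes "module K V" "module K W" "linear_map K V W f" "finite A" "g \<in> A \<rightarrow> carrier V"
  shows "f (\<Oplus>\<^bsub>V\<^esub>i\<in>A. g i) = (\<Oplus>\<^bsub>W\<^esub>i\<in>A. f (g i))"
proof -
  interpret V: module K V by fact
  interpret W: module K W by fact
  show ?thesis using assms(4,5)
  proof (induction A)
    case empty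
    then show ?case using linear_map_zero[OF assms(1-3)] by simp
  next
    case (insert x F)
    have "f (\<Oplus>\<^bsub>V\<^esub>i\<in>insert x F. g i) = f (g x \<oplus>\<^bsub>V\<^esub> (\<Oplus>\<^bsub>V\<^esub>i\<in>F. g i))"
      using insert by (subst V.finsum_insert) auto
    also have "\<dots> = f (g x) \<oplus>\<^bsub>W\<^esub> (\<Oplus>\<^bsub>W\<^esub>i\<in>F. f (g i))"
      using insert by (subst linear_map_add[OF assms(3)]) (auto intro!: V.finsum_closed)
    also have "\<dots> = (\<Oplus>\<^bsub>W\<^esub>i\<in>insert x F. f (g i))"
      using insert linear_map_closed[OF assms(3)] by (subst W.finsum_insert) (auto simp: Pi_iff)
    finally show ?case .
  qed
qed

section \<open>Quotient modules\<close>

context module begin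

lemma abelian_subgroup_of_submodule:
  assumes "submodule N R M" shows "abelian_subgroup N M"
  using assms by (intro abelian_subgroupI3 additive_subgroup.intro abelian_group_axioms)
    (simp add: submodule_def)

lemma submodule_generated_submodule:
  assumes "S \<subseteq> carrier M" shows "submodule (generated_submodule R M S) R M"
proof -
  have *: "carrier M \<in> {N. submodule N R M \<and> S \<subseteq> N}"
    using carrier_is_submodule assms by simp
  show ?thesis
    unfolding generated_submodule_def
  proof (rule submoduleI)
    show "\<Inter> {N. submodule N R M \<and> S \<subseteq> N} \<subseteq> carrier M" using * by blast
    show "\<zero>\<^bsub>M\<^esub> \<in> \<Inter> {N. submodule N R M \<and> S \<subseteq> N}"
      by (auto simp: submodule_def dest: subgroup.one_closed)
  qed (auto dest: submoduleE)
qed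

lemma generated_submodule_least:
  "submodule N R M \<Longrightarrow> S \<subseteq> N \<Longrightarrow> generated_submodule R M S \<subseteq> N"
  by (auto simp: generated_submodule_def)

lemma generated_submodule_superset: "S \<subseteq> generated_submodule R M S"
  by (auto simp: generated_submodule_def)

lemma submodule_kernel:
  assumes "module R W" "linear_map R M W f"
  shows "submodule {x \<in> carrier M. f x = \<zero>\<^bsub>W\<^esub>} R M"
proof -
  interpret W: module R W by fact
  note f = linear_mapD[OF assms(2)]
  have neg: "f (\<ominus>\<^bsub>M\<^esub> x) = \<ominus>\<^bsub>W\<^esub> f x" if "x \<in> carrier M" for x
    using linear_map_minus[OF module_axioms assms, of "\<zero>\<^bsub>M\<^esub>" x] that f(1)
      linear_map_zero[OF module_axioms assms] by (simp add: minus_eq W.minus_eq)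
  show ?thesis
    by (rule submoduleI) (auto simp: f neg linear_map_zero[OF module_axioms assms])
qed

context
  fixes N assumes N: "submodule N R M"
begin

interpretation N: abelian_subgroup N M by (rule abelian_subgroup_of_submodule[OF N])

lemma quotient_carrierE:
  assumes "X \<in> carrier (quotient_module M N)"
  obtains x where "x \<in> carrier M" "X = N +>\<^bsub>M\<^esub> x"
  using assms by (auto simp: quotient_module_def A_RCOSETS_def')

lemma quotient_carrierI: "x \<in> carrier M \<Longrightarrow> N +>\<^bsub>M\<^esub> x \<in> carrier (quotient_module M N)"
  by (auto simp: quotient_module_def A_RCOSETS_def')

lemma quotient_add:
  "x \<in> carrier M \<Longrightarrow> y \<in> carrier M \<Longrightarrow>
    (N +>\<^bsub>M\<^esub> x) \<oplus>\<^bsub>quotient_module M N\<^esub> (N +>\<^bsub>M\<^esub> y) = N +>\<^bsub>M\<^esub> (x \<oplus>\<^bsub>M\<^esub> y)"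
  by (simp add: quotient_module_def N.a_rcos_sum)

lemma quotient_smult:
  assumes "a \<in> carrier R" "x \<in> carrier M"
  shows "a \<odot>\<^bsub>quotient_module M N\<^esub> (N +>\<^bsub>M\<^esub> x) = N +>\<^bsub>M\<^esub> (a \<odot>\<^bsub>M\<^esub> x)"
proof -
  have "N <+>\<^bsub>M\<^esub> (\<lambda>y. a \<odot>\<^bsub>M\<^esub> y) ` (N +>\<^bsub>M\<^esub> x) = N +>\<^bsub>M\<^esub> (a \<odot>\<^bsub>M\<^esub> x)"
  proof (intro equalityI subsetI)
    fix z assume "z \<in> N <+>\<^bsub>M\<^esub> (\<lambda>y. a \<odot>\<^bsub>M\<^esub> y) ` (N +>\<^bsub>M\<^esub> x)"
    then obtain n k where nk: "n \<in> N" "k \<in> N" "z = n \<oplus>\<^bsub>M\<^esub> a \<odot>\<^bsub>M\<^esub> (k \<oplus>\<^bsub>M\<^esub> x)"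
      by (auto simp: set_add_def' a_r_coset_def')
    have k: "n \<in> carrier M" "k \<in> carrier M" "a \<odot>\<^bsub>M\<^esub> k \<in> N"
      using nk assms submoduleE[OF N] by auto
    have "z = (n \<oplus>\<^bsub>M\<^esub> a \<odot>\<^bsub>M\<^esub> k) \<oplus>\<^bsub>M\<^esub> a \<odot>\<^bsub>M\<^esub> x"
      using nk k assms by (simp add: smult_r_distr add.m_assoc)
    moreover have "n \<oplus>\<^bsub>M\<^esub> a \<odot>\<^bsub>M\<^esub> k \<in> N" using nk k submoduleE[OF N] by auto
    ultimately show "z \<in> N +>\<^bsub>M\<^esub> (a \<odot>\<^bsub>M\<^esub> x)" by (auto simp: a_r_coset_def')
  next
    fix z assume "z \<in> N +>\<^bsub>M\<^esub> (a \<odot>\<^bsub>M\<^esub> x)"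
    then obtain n where n: "n \<in> N" "z = n \<oplus>\<^bsub>M\<^esub> a \<odot>\<^bsub>M\<^esub> x" by (auto simp: a_r_coset_def')
    moreover have "x \<in> N +>\<^bsub>M\<^esub> x" using assms by (simp add: N.a_rcos_self)
    ultimately show "z \<in> N <+>\<^bsub>M\<^esub> (\<lambda>y. a \<odot>\<^bsub>M\<^esub> y) ` (N +>\<^bsub>M\<^esub> x)"
      by (auto simp: set_add_def')
  qed
  then show ?thesis by (simp add: quotient_module_def)
qed

lemma quotient_zero: "\<zero>\<^bsub>quotient_module M N\<^esub> = N +>\<^bsub>M\<^esub> \<zero>\<^bsub>M\<^esub>"
  using submoduleE(1)[OF N] by (simp add: quotient_module_def)

lemma module_quotient: "module R (quotient_module M N)"
proof (rule moduleI)
  let ?Q = "quotient_module M N"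
  show "abelian_group ?Q"
  proof (rule abelian_groupI)
    fix x y z assume "x \<in> carrier ?Q" "y \<in> carrier ?Q" "z \<in> carrier ?Q"
    then obtain x' y' z' where xyz: "x' \<in> carrier M" "x = N +>\<^bsub>M\<^esub> x'"
      "y' \<in> carrier M" "y = N +>\<^bsub>M\<^esub> y'" "z' \<in> carrier M" "z = N +>\<^bsub>M\<^esub> z'"
      by (metis quotient_carrierE)
    show "x \<oplus>\<^bsub>?Q\<^esub> y \<in> carrier ?Q"
      using xyz by (simp add: quotient_add quotient_carrierI)
    show "x \<oplus>\<^bsub>?Q\<^esub> y \<oplus>\<^bsub>?Q\<^esub> z = x \<oplus>\<^bsub>?Q\<^esub> (y \<oplus>\<^bsub>?Q\<^esub> z)"
      using xyz by (simp add: quotient_add add.m_assoc)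
    show "x \<oplus>\<^bsub>?Q\<^esub> y = y \<oplus>\<^bsub>?Q\<^esub> x"
      using xyz by (simp add: quotient_add add.m_comm)
  next
    fix x assume "x \<in> carrier ?Q"
    then obtain x' where x: "x' \<in> carrier M" "x = N +>\<^bsub>M\<^esub> x'" by (metis quotient_carrierE)
    show "\<zero>\<^bsub>?Q\<^esub> \<oplus>\<^bsub>?Q\<^esub> x = x"
      using x by (simp add: quotient_zero quotient_add)
    show "\<exists>y\<in>carrier ?Q. y \<oplus>\<^bsub>?Q\<^esub> x = \<zero>\<^bsub>?Q\<^esub>"
      using x by (intro bexI[of _ "N +>\<^bsub>M\<^esub> (\<ominus>\<^bsub>M\<^esub> x')"])
        (simp_all add: quotient_zero quotient_add quotient_carrierI l_neg)
  qed (simp add: quotient_zero quotient_carrierI)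
next
  let ?Q = "quotient_module M N"
  fix a b x y assume ab: "a \<in> carrier R" "b \<in> carrier R" and "x \<in> carrier ?Q" "y \<in> carrier ?Q"
  then obtain x' y' where xy: "x' \<in> carrier M" "x = N +>\<^bsub>M\<^esub> x'" "y' \<in> carrier M" "y = N +>\<^bsub>M\<^esub> y'"
    by (metis quotient_carrierE)
  show "a \<odot>\<^bsub>?Q\<^esub> (x \<oplus>\<^bsub>?Q\<^esub> y) = (a \<odot>\<^bsub>?Q\<^esub> x) \<oplus>\<^bsub>?Q\<^esub> (a \<odot>\<^bsub>?Q\<^esub> y)"
    using ab xy by (simp add: quotient_smult quotient_add smult_r_distr)
next
  let ?Q = "quotient_module M N"
  fix a x assume ab: "a \<in> carrier R" and "x \<in> carrier ?Q"
  then obtain x' where xy: "x' \<in> carrier M" "x = N +>\<^bsub>M\<^esub> x'"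
    by (metis quotient_carrierE)
  show "a \<odot>\<^bsub>?Q\<^esub> x \<in> carrier ?Q"
    using ab xy by (simp add: quotient_smult quotient_carrierI)
  fix b assume b: "b \<in> carrier R"
  show "(a \<oplus> b) \<odot>\<^bsub>?Q\<^esub> x = (a \<odot>\<^bsub>?Q\<^esub> x) \<oplus>\<^bsub>?Q\<^esub> (b \<odot>\<^bsub>?Q\<^esub> x)"
    using ab b xy by (simp add: quotient_smult quotient_add smult_l_distr)
  show "(a \<otimes> b) \<odot>\<^bsub>?Q\<^esub> x = a \<odot>\<^bsub>?Q\<^esub> (b \<odot>\<^bsub>?Q\<^esub> x)"
    using ab b xy by (simp add: quotient_smult smult_assoc1)
next
  fix x assume "x \<in> carrier (quotient_module M N)"
  then obtain x' where "x' \<in> carrier M" "x = N +>\<^bsub>M\<^esub> x'"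
    by (metis quotient_carrierE)
  then show "\<one> \<odot>\<^bsub>quotient_module M N\<^esub> x = x"
    by (simp add: quotient_smult)
qed (rule R.is_cring)

lemma quotient_eq_iff:
  assumes "x \<in> carrier M" "y \<in> carrier M"
  shows "N +>\<^bsub>M\<^esub> x = N +>\<^bsub>M\<^esub> y \<longleftrightarrow> x \<ominus>\<^bsub>M\<^esub> y \<in> N"
  using assms N.a_rcos_module[of y x] N.a_rcos_self[of x]
    N.a_repr_independence'[of x y] by (auto simp: minus_eq)

lemma linear_map_coset: "linear_map R M (quotient_module M N) (\<lambda>x. N +>\<^bsub>M\<^esub> x)"
  by (rule linear_mapI) (auto simp: quotient_carrierI quotient_add quotient_smult)

end

end

section \<open>Free modules and their linear extensions\<close>

text \<open>
  \<open>free_extend K P b\<close> is the linear extension to the free module of a family \<open>b\<close> of elements of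
  \<open>P\<close> that is indexed by the basis.
\<close>

definition free_extend ::
  "('k, 'c) ring_scheme \<Rightarrow> ('k, 'p, 'z) module_scheme \<Rightarrow> ('x \<Rightarrow> 'p) \<Rightarrow> ('x \<Rightarrow> 'k) \<Rightarrow> 'p"
  where "free_extend K P b p = (\<Oplus>\<^bsub>P\<^esub>z \<in> {z. p z \<noteq> \<zero>\<^bsub>K\<^esub>}. p z \<odot>\<^bsub>P\<^esub> b z)"

context cring begin

abbreviation free where "free X \<equiv> free_module R X"

lemma free_carrier_iff:
  "p \<in> carrier (free X) \<longleftrightarrow> (\<forall>x. p x \<in> carrier R) \<and> finite {x. p x \<noteq> \<zero>} \<and> (\<forall>x. p x \<noteq> \<zero> \<longrightarrow> x \<in> X)"
  by (auto simp: free_module_def)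

lemma free_simps [simp]:
  "\<zero>\<^bsub>free X\<^esub> = (\<lambda>_. \<zero>)"
  "p \<oplus>\<^bsub>free X\<^esub> q = (\<lambda>x. p x \<oplus> q x)"
  "a \<odot>\<^bsub>free X\<^esub> p = (\<lambda>x. a \<otimes> p x)"
  by (simp_all add: free_module_def)

lemma free_add_closed:
  assumes "p \<in> carrier (free X)" "q \<in> carrier (free X)"
  shows "(\<lambda>x. p x \<oplus> q x) \<in> carrier (free X)"
proof -
  have "finite {x. p x \<oplus> q x \<noteq> \<zero>}"
    by (rule finite_subset[of _ "{x. p x \<noteq> \<zero>} \<union> {x. q x \<noteq> \<zero>}"])
      (use assms in \<open>auto simp: free_carrier_iff\<close>)
  moreover have "p x \<oplus> q x \<noteq> \<zero> \<Longrightarrow> x \<in> X" for x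
    using assms unfolding free_carrier_iff by (metis l_zero zero_closed)
  ultimately show ?thesis
    using assms by (auto simp: free_carrier_iff)
qed

lemma free_smult_closed:
  assumes "a \<in> carrier R" "p \<in> carrier (free X)"
  shows "(\<lambda>x. a \<otimes> p x) \<in> carrier (free X)"
proof -
  have "finite {x. a \<otimes> p x \<noteq> \<zero>}"
    by (rule finite_subset[of _ "{x. p x \<noteq> \<zero>}"])
      (use assms in \<open>auto simp: free_carrier_iff\<close>)
  moreover have "a \<otimes> p x \<noteq> \<zero> \<Longrightarrow> x \<in> X" for x
    using assms unfolding free_carrier_iff by (metis r_null)
  ultimately show ?thesis
    using assms by (auto simp: free_carrier_iff)
qed

lemma module_free: "module R (free X)"
proof (rule moduleI)
  show "abelian_group (free X)"
  proof (rule abelian_groupI)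
    fix p assume p: "p \<in> carrier (free X)"
    have "(\<lambda>x. \<ominus> \<one> \<otimes> p x) \<in> carrier (free X)" by (rule free_smult_closed) (use p in auto)
    moreover have "\<ominus> \<one> \<otimes> p x \<oplus> p x = \<zero>" for x
      using p by (auto simp: free_carrier_iff l_minus l_neg)
    ultimately show "\<exists>q\<in>carrier (free X). q \<oplus>\<^bsub>free X\<^esub> p = \<zero>\<^bsub>free X\<^esub>"
      by (intro bexI[of _ "\<lambda>x. \<ominus> \<one> \<otimes> p x"]) auto
  next
    fix p q assume "p \<in> carrier (free X)" "q \<in> carrier (free X)"
    then show "p \<oplus>\<^bsub>free X\<^esub> q \<in> carrier (free X)" by (simp add: free_add_closed)
  qed (auto simp: free_carrier_iff a_ac)
next
  fix a p assume "a \<in> carrier R" "p \<in> carrier (free X)"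
  then show "a \<odot>\<^bsub>free X\<^esub> p \<in> carrier (free X)" by (simp add: free_smult_closed)
qed (auto simp: is_cring free_carrier_iff l_distr r_distr m_assoc)

lemma single_closed: "x \<in> X \<Longrightarrow> single R x \<in> carrier (free X)"
  by (auto simp: single_def free_carrier_iff)

lemma free_extend_eq:
  assumes "module R P" "p \<in> carrier (free X)" "b \<in> X \<rightarrow> carrier P"
    and "finite S" "{x. p x \<noteq> \<zero>} \<subseteq> S" "S \<subseteq> X"
  shows "free_extend R P b p = (\<Oplus>\<^bsub>P\<^esub>z \<in> S. p z \<odot>\<^bsub>P\<^esub> b z)"
proof -
  interpret P: module R P by fact
  show ?thesis unfolding free_extend_def
    by (rule P.add.finprod_mono_neutral_cong_left)
      (use assms in \<open>auto simp: free_carrier_iff Pi_iff subset_iff\<close>)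
qed

lemma linear_map_free_extend:
  assumes "module R P" "b \<in> X \<rightarrow> carrier P"
  shows "linear_map R (free X) P (free_extend R P b)"
proof -
  interpret P: module R P by fact
  show ?thesis
  proof (rule linear_mapI)
    fix p assume p: "p \<in> carrier (free X)"
    then show "free_extend R P b p \<in> carrier P"
      using assms(2) unfolding free_extend_def free_carrier_iff
      by (intro P.finsum_closed) (auto simp: Pi_iff)
    fix a assume a: "a \<in> carrier R"
    let ?S = "{x. p x \<noteq> \<zero>}"
    have S: "finite ?S" "?S \<subseteq> X" using p by (auto simp: free_carrier_iff)
    have ap: "a \<odot>\<^bsub>free X\<^esub> p \<in> carrier (free X)" using a p by (simp add: free_smult_closed)
    have "free_extend R P b (a \<odot>\<^bsub>free X\<^esub> p) = (\<Oplus>\<^bsub>P\<^esub>z \<in> ?S. (a \<otimes> p z) \<odot>\<^bsub>P\<^esub> b z)"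
      using S a by (subst free_extend_eq[OF assms(1) ap assms(2) S(1)]) auto
    also have "\<dots> = (\<Oplus>\<^bsub>P\<^esub>z \<in> ?S. a \<odot>\<^bsub>P\<^esub> (p z \<odot>\<^bsub>P\<^esub> b z))"
      using S a p assms(2)
      by (intro P.finsum_cong') (auto simp: free_carrier_iff P.smult_assoc1 Pi_iff subset_iff)
    also have "\<dots> = a \<odot>\<^bsub>P\<^esub> free_extend R P b p"
      unfolding free_extend_def using S a p assms(2)
      by (intro P.finsum_smult_ldistr[symmetric]) (auto simp: free_carrier_iff Pi_iff)
    finally show "free_extend R P b (a \<odot>\<^bsub>free X\<^esub> p) = a \<odot>\<^bsub>P\<^esub> free_extend R P b p" .
  next
    fix p q assume p: "p \<in> carrier (free X)" and q: "q \<in> carrier (free X)"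
    let ?S = "{x. p x \<noteq> \<zero>} \<union> {x. q x \<noteq> \<zero>}"
    have S: "finite ?S" "?S \<subseteq> X" using p q by (auto simp: free_carrier_iff)
    have pq: "p \<oplus>\<^bsub>free X\<^esub> q \<in> carrier (free X)" using p q by (simp add: free_add_closed)
    have "free_extend R P b (p \<oplus>\<^bsub>free X\<^esub> q) = (\<Oplus>\<^bsub>P\<^esub>z \<in> ?S. (p z \<oplus> q z) \<odot>\<^bsub>P\<^esub> b z)"
      using S by (subst free_extend_eq[OF assms(1) pq assms(2) S(1)]) auto
    also have "\<dots> = (\<Oplus>\<^bsub>P\<^esub>z \<in> ?S. p z \<odot>\<^bsub>P\<^esub> b z \<oplus>\<^bsub>P\<^esub> q z \<odot>\<^bsub>P\<^esub> b z)"
      using S p q assms(2)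
      by (intro P.finsum_cong') (auto simp: free_carrier_iff P.smult_l_distr Pi_iff)
    also have "\<dots> = (\<Oplus>\<^bsub>P\<^esub>z \<in> ?S. p z \<odot>\<^bsub>P\<^esub> b z) \<oplus>\<^bsub>P\<^esub> (\<Oplus>\<^bsub>P\<^esub>z \<in> ?S. q z \<odot>\<^bsub>P\<^esub> b z)"
      using S p q assms(2)
      by (intro P.finsum_addf) (auto simp: free_carrier_iff Pi_iff)
    also have "\<dots> = free_extend R P b p \<oplus>\<^bsub>P\<^esub> free_extend R P b q"
      using free_extend_eq[OF assms(1) p assms(2) S(1) _ S(2)]
        free_extend_eq[OF assms(1) q assms(2) S(1) _ S(2)] by simp
    finally show "free_extend R P b (p \<oplus>\<^bsub>free X\<^esub> q) = free_extend R P b p \<oplus>\<^bsub>P\<^esub> free_extend R P b q" .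
  qed
qed

lemma free_extend_single:
  assumes "module R P" "x \<in> X" "b \<in> X \<rightarrow> carrier P"
  shows "free_extend R P b (single R x) = b x"
proof -
  interpret P: module R P by fact
  have "free_extend R P b (single R x) = (\<Oplus>\<^bsub>P\<^esub>z \<in> {x}. single R x z \<odot>\<^bsub>P\<^esub> b z)"
    using assms by (intro free_extend_eq[of _ _ X]) (auto simp: single_closed, simp add: single_def split: if_splits)
  also have "\<dots> = b x"
    using assms by (subst P.finsum_insert) (auto simp: single_def Pi_iff)
  finally show ?thesis .
qed

text \<open>A linear map on a free module is determined by its values on the basis.\<close>

lemma free_linear_ext:
  assumes "module R P" "linear_map R (free X) P f" "linear_map R (free X) P g"
    and eq: "\<And>x. x \<in> X \<Longrightarrow> f (single R x) = g (single R x)"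
    and p: "p \<in> carrier (free X)"
  shows "f p = g p"
proof -
  have "finite {x. p x \<noteq> \<zero>}" using p by (simp add: free_carrier_iff)
  moreover have "f p = g p" if "finite S" "{x. p x \<noteq> \<zero>} \<subseteq> S" "p \<in> carrier (free X)" for S p
    using that
  proof (induction S arbitrary: p)
    case empty
    then have "p = \<zero>\<^bsub>free X\<^esub>" by auto
    then show ?case
      using linear_map_zero[OF module_free assms(1,2)] linear_map_zero[OF module_free assms(1,3)]
      by simp
  next
    case (insert x S)
    define q where "q = p(x := \<zero>)"
    have q: "q \<in> carrier (free X)" "{x. q x \<noteq> \<zero>} \<subseteq> S"
      using insert.prems by (auto simp: q_def free_carrier_iff elim!: rev_finite_subset)
    show ?case
    proof (cases "p x = \<zero>")
      case True
      then have "p = q" by (auto simp: q_def)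
      then show ?thesis using insert.IH q by simp
    next
      case False
      then have x: "x \<in> X" "p x \<in> carrier R" using insert.prems by (auto simp: free_carrier_iff)
      have s: "single R x \<in> carrier (free X)" using x by (simp add: single_closed)
      have ps: "p x \<odot>\<^bsub>free X\<^esub> single R x \<in> carrier (free X)"
        using x s by (simp add: free_smult_closed)
      have p: "p = q \<oplus>\<^bsub>free X\<^esub> (p x \<odot>\<^bsub>free X\<^esub> single R x)"
        using insert.prems(2) by (auto simp: q_def single_def free_carrier_iff fun_eq_iff)
      show ?thesis
        by (subst (1 2) p, unfold linear_map_add[OF assms(2) q(1) ps] linear_map_add[OF assms(3) q(1) ps]
            linear_map_smult[OF assms(2) x(2) s] linear_map_smult[OF assms(3) x(2) s])
          (simp add: eq x insert.IH[OF q(2,1)])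
    qed
  qed
  ultimately show ?thesis using p by blast
qed

section \<open>The universal property of the tensor product\<close>

lemma tensor_relations_subset:
  assumes "module R V" "module R W"
  shows "tensor_relations R V W \<subseteq> carrier (free (carrier V \<times> carrier W))"
proof -
  interpret V: module R V by fact
  interpret W: module R W by fact
  interpret F: module R "free (carrier V \<times> carrier W)" by (rule module_free)
  show ?thesis unfolding tensor_relations_def Let_def
    by (auto intro!: F.minus_closed F.add.m_closed F.smult_closed single_closed simp del: free_simps)
qed

lemma submodule_tensor_null:
  assumes "module R V" "module R W"
  shows "submodule (tensor_null R V W) R (free (carrier V \<times> carrier W))"
  unfolding tensor_null_def
  by (rule module.submodule_generated_submodule[OF module_free tensor_relations_subset[OF assms]])

lemma module_tensor:
  assumes "module R V" "module R W" shows "module R (V \<boxtimes> W)"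
  unfolding tensor_def
  by (rule module.module_quotient[OF module_free submodule_tensor_null[OF assms]])

text \<open>The linear extension of a bilinear map respects the relations of the tensor product.\<close>

lemma free_extend_tensor_null:
  assumes "module R V" "module R W" "module R P" "bilinear_map R V W P b"
    and p: "p \<in> tensor_null R V W"
  shows "free_extend R P (\<lambda>z. b (fst z) (snd z)) p = \<zero>\<^bsub>P\<^esub>"
proof -
  interpret V: module R V by fact
  interpret W: module R W by fact
  interpret P: module R P by fact
  let ?F = "free (carrier V \<times> carrier W)"
  interpret F: module R ?F by (rule module_free)
  let ?b = "\<lambda>z. b (fst z) (snd z)"
  let ?f = "free_extend R P ?b"
  have b: "?b \<in> carrier V \<times> carrier W \<rightarrow> carrier P"
    using bilinear_map_closed[OF assms(4)] by auto
  note f = linear_map_free_extend[OF assms(3) b]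
  have s: "?f (single R (v, w)) = b v w" if "v \<in> carrier V" "w \<in> carrier W" for v w
    using that by (subst free_extend_single[OF assms(3) _ b]) auto
  have c: "single R (v, w) \<in> carrier ?F" if "v \<in> carrier V" "w \<in> carrier W" for v w
    using that by (simp add: single_closed)
  have bc: "b v w \<in> carrier P" if "v \<in> carrier V" "w \<in> carrier W" for v w
    using that bilinear_map_closed[OF assms(4)] by simp
  note simps = linear_map_minus[OF F.module_axioms assms(3) f] linear_map_add[OF f]
    linear_map_smult[OF f] s c F.add.m_closed F.smult_closed bc P.minus_eq P.r_neg
    linear_map_add[OF bilinear_map_left[OF assms(4)]] linear_map_smult[OF bilinear_map_left[OF assms(4)]]
    linear_map_add[OF bilinear_map_right[OF assms(4)]] linear_map_smult[OF bilinear_map_right[OF assms(4)]]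
  have "tensor_relations R V W \<subseteq> {x \<in> carrier ?F. ?f x = \<zero>\<^bsub>P\<^esub>}"
    using tensor_relations_subset[OF assms(1,2)] unfolding tensor_relations_def Let_def
    by (auto simp: simps simp del: free_simps)
  then show ?thesis
    using p F.generated_submodule_least[OF F.submodule_kernel[OF assms(3) f]]
    unfolding tensor_null_def by blast
qed

lemma ptensor_closed:
  assumes "module R V" "module R W" "v \<in> carrier V" "w \<in> carrier W"
  shows "ptensor R V W v w \<in> carrier (V \<boxtimes> W)"
  unfolding tensor_def ptensor_def using assms(3,4)
  by (intro module.quotient_carrierI[OF module_free submodule_tensor_null[OF assms(1,2)]] single_closed) auto

lemma bilinear_map_ptensor:
  assumes "module R V" "module R W"
  shows "bilinear_map R V W (V \<boxtimes> W) (ptensor R V W)"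
proof -
  interpret V: module R V by fact
  interpret W: module R W by fact
  let ?F = "free (carrier V \<times> carrier W)"
  interpret F: module R ?F by (rule module_free)
  let ?N = "tensor_null R V W"
  note N = submodule_tensor_null[OF assms]
  note q = F.quotient_eq_iff[OF N] F.quotient_add[OF N] F.quotient_smult[OF N]
  have c: "single R (v, w) \<in> carrier ?F" if "v \<in> carrier V" "w \<in> carrier W" for v w
    using that by (simp add: single_closed)
  have sub: "x \<in> ?N" if "x \<in> tensor_relations R V W" for x
    using F.generated_submodule_superset that unfolding tensor_null_def by blast
  have rel: "v \<in> carrier V \<Longrightarrow> v' \<in> carrier V \<Longrightarrow> w \<in> carrier W \<Longrightarrow>
      single R (v \<oplus>\<^bsub>V\<^esub> v', w) \<ominus>\<^bsub>?F\<^esub> (single R (v, w) \<oplus>\<^bsub>?F\<^esub> single R (v', w)) \<in> ?N"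
    "v \<in> carrier V \<Longrightarrow> w \<in> carrier W \<Longrightarrow> w' \<in> carrier W \<Longrightarrow>
      single R (v, w \<oplus>\<^bsub>W\<^esub> w') \<ominus>\<^bsub>?F\<^esub> (single R (v, w) \<oplus>\<^bsub>?F\<^esub> single R (v, w')) \<in> ?N"
    "a \<in> carrier R \<Longrightarrow> v \<in> carrier V \<Longrightarrow> w \<in> carrier W \<Longrightarrow>
      single R (a \<odot>\<^bsub>V\<^esub> v, w) \<ominus>\<^bsub>?F\<^esub> (a \<odot>\<^bsub>?F\<^esub> single R (v, w)) \<in> ?N"
    "a \<in> carrier R \<Longrightarrow> v \<in> carrier V \<Longrightarrow> w \<in> carrier W \<Longrightarrow>
      single R (v, a \<odot>\<^bsub>W\<^esub> w) \<ominus>\<^bsub>?F\<^esub> (a \<odot>\<^bsub>?F\<^esub> single R (v, w)) \<in> ?N" for v v' w w' a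
    by (rule sub, unfold tensor_relations_def Let_def, blast)+
  show ?thesis
    by (intro bilinear_mapI linear_mapI ptensor_closed assms; assumption?)
      (unfold ptensor_def tensor_def,
        simp_all add: q c rel F.add.m_closed F.smult_closed del: free_simps)
qed

text \<open>For bilinear \<open>b\<close>, a Sweedler sum does not depend on the representative that is chosen in it.\<close>

lemma sweedler_coset:
  assumes "module R V" "module R W" "module R P" "bilinear_map R V W P b"
    and p: "p \<in> carrier (free (carrier V \<times> carrier W))"
  shows "sweedler R P (tensor_null R V W +>\<^bsub>free (carrier V \<times> carrier W)\<^esub> p) b =
    free_extend R P (\<lambda>z. b (fst z) (snd z)) p"
proof -
  let ?F = "free (carrier V \<times> carrier W)"
  let ?N = "tensor_null R V W"
  interpret P: module R P by fact
  interpret F: module R ?F by (rule module_free)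
  note N = submodule_tensor_null[OF assms(1,2)]
  interpret N: abelian_subgroup ?N ?F by (rule F.abelian_subgroup_of_submodule[OF N])
  let ?f = "free_extend R P (\<lambda>z. b (fst z) (snd z))"
  have b: "(\<lambda>z. b (fst z) (snd z)) \<in> carrier V \<times> carrier W \<rightarrow> carrier P"
    using bilinear_map_closed[OF assms(4)] by auto
  note f = linear_map_free_extend[OF assms(3) b]
  define q where "q = (SOME q. q \<in> ?N +>\<^bsub>?F\<^esub> p)"
  have "q \<in> ?N +>\<^bsub>?F\<^esub> p"
    unfolding q_def by (rule someI[of _ p]) (rule N.a_rcos_self[OF p])
  then obtain n where n: "n \<in> ?N" "q = n \<oplus>\<^bsub>?F\<^esub> p" by (auto simp: a_r_coset_def')
  have "?f q = ?f n \<oplus>\<^bsub>P\<^esub> ?f p"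
    unfolding n(2) using n(1) p N.a_subset by (intro linear_map_add[OF f]) auto
  also have "\<dots> = ?f p"
    using free_extend_tensor_null[OF assms(1-4) n(1)] linear_map_closed[OF f p] by simp
  finally show ?thesis
    by (simp add: sweedler_def q_def[symmetric] free_extend_def Let_def)
qed

lemma sweedler_ptensor:
  assumes "bilinear_map R V W P b" "v \<in> carrier V" "w \<in> carrier W"
    and "module R V" "module R W" "module R P"
  shows "sweedler R P (ptensor R V W v w) b = b v w"
proof -
  have b: "(\<lambda>z. b (fst z) (snd z)) \<in> carrier V \<times> carrier W \<rightarrow> carrier P"
    using bilinear_map_closed[OF assms(1)] by auto
  show ?thesis
    using assms(2,3) unfolding ptensor_def
    by (subst sweedler_coset[OF assms(4-6,1)])
      (auto simp: single_closed free_extend_single[OF assms(6) _ b])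
qed

lemma linear_map_sweedler:
  assumes "bilinear_map R V W P b" "module R V" "module R W" "module R P"
  shows "linear_map R (V \<boxtimes> W) P (\<lambda>t. sweedler R P t b)"
proof -
  let ?F = "free (carrier V \<times> carrier W)"
  interpret F: module R ?F by (rule module_free)
  note N = submodule_tensor_null[OF assms(2,3)]
  note s = sweedler_coset[OF assms(2-4,1)]
  have b: "(\<lambda>z. b (fst z) (snd z)) \<in> carrier V \<times> carrier W \<rightarrow> carrier P"
    using bilinear_map_closed[OF assms(1)] by auto
  note f = linear_map_free_extend[OF assms(4) b]
  show ?thesis
    unfolding tensor_def
  proof (rule linear_mapI)
    fix X assume "X \<in> carrier (quotient_module ?F (tensor_null R V W))"
    then obtain x where x: "x \<in> carrier ?F" "X = tensor_null R V W +>\<^bsub>?F\<^esub> x"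
      by (rule F.quotient_carrierE[OF N])
    then show "sweedler R P X b \<in> carrier P"
      using linear_map_closed[OF f] by (simp add: s)
    fix a assume "a \<in> carrier R"
    then show "sweedler R P (a \<odot>\<^bsub>quotient_module ?F (tensor_null R V W)\<^esub> X) b =
        a \<odot>\<^bsub>P\<^esub> sweedler R P X b"
      using x linear_map_smult[OF f]
      by (simp add: s F.quotient_smult[OF N] F.smult_closed del: free_simps)
  next
    fix X Y assume "X \<in> carrier (quotient_module ?F (tensor_null R V W))"
      "Y \<in> carrier (quotient_module ?F (tensor_null R V W))"
    then obtain x y where "x \<in> carrier ?F" "X = tensor_null R V W +>\<^bsub>?F\<^esub> x"
      "y \<in> carrier ?F" "Y = tensor_null R V W +>\<^bsub>?F\<^esub> y"
      by (metis F.quotient_carrierE[OF N])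
    then show "sweedler R P (X \<oplus>\<^bsub>quotient_module ?F (tensor_null R V W)\<^esub> Y) b =
        sweedler R P X b \<oplus>\<^bsub>P\<^esub> sweedler R P Y b"
      using linear_map_add[OF f]
      by (simp add: s F.quotient_add[OF N] F.add.m_closed del: free_simps)
  qed
qed

text \<open>A linear map on a tensor product is determined by its values on pure tensors.\<close>

lemma tensor_linear_ext:
  assumes "linear_map R (V \<boxtimes> W) P f" "linear_map R (V \<boxtimes> W) P g"
    and eq: "\<And>v w. v \<in> carrier V \<Longrightarrow> w \<in> carrier W \<Longrightarrow> f (ptensor R V W v w) = g (ptensor R V W v w)"
    and t: "t \<in> carrier (V \<boxtimes> W)"
    and "module R V" "module R W" "module R P"
  shows "f t = g t"
proof -
  let ?F = "free (carrier V \<times> carrier W)"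
  interpret F: module R ?F by (rule module_free)
  note N = submodule_tensor_null[OF assms(5,6)]
  let ?q = "\<lambda>x. tensor_null R V W +>\<^bsub>?F\<^esub> x"
  obtain x where x: "x \<in> carrier ?F" "t = ?q x"
    using t unfolding tensor_def by (rule F.quotient_carrierE[OF N])
  have q: "linear_map R ?F (V \<boxtimes> W) ?q"
    unfolding tensor_def by (rule F.linear_map_coset[OF N])
  have "f (?q x) = g (?q x)"
    by (rule free_linear_ext[OF assms(7) linear_map_comp[OF assms(1) q] linear_map_comp[OF assms(2) q] _ x(1)])
      (use eq in \<open>auto simp: ptensor_def\<close>)
  then show ?thesis by (simp add: x)
qed

end

section \<open>Calculus of Sweedler sums\<close>

text \<open>
  The coefficients and the index set of the linear combination that defines a Sweedler sum over \<open>t\<close>.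
  They depend on \<open>t\<close> only, so facts that use nothing else, such as the exchange of two independent
  sums, need no bilinearity of the summand.
\<close>

definition tensor_coeff :: "('x \<Rightarrow> 'k) set \<Rightarrow> 'x \<Rightarrow> 'k"
  where "tensor_coeff t = (SOME p. p \<in> t)"

definition tensor_support :: "('k, 'c) ring_scheme \<Rightarrow> ('x \<Rightarrow> 'k) set \<Rightarrow> 'x set"
  where "tensor_support K t = {z. tensor_coeff t z \<noteq> \<zero>\<^bsub>K\<^esub>}"

lemma sweedler_eq_finsum:
  "sweedler K P t b =
    (\<Oplus>\<^bsub>P\<^esub>z\<in>tensor_support K t. tensor_coeff t z \<odot>\<^bsub>P\<^esub> b (fst z) (snd z))"
  by (simp add: sweedler_def tensor_support_def tensor_coeff_def Let_def)

context cring begin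

lemma tensor_support:
  assumes "t \<in> carrier (V \<boxtimes> W)" "module R V" "module R W"
  shows "finite (tensor_support R t)" "tensor_support R t \<subseteq> carrier V \<times> carrier W"
    "tensor_coeff t \<in> tensor_support R t \<rightarrow> carrier R"
proof -
  let ?F = "free (carrier V \<times> carrier W)"
  interpret F: module R ?F by (rule module_free)
  note N = submodule_tensor_null[OF assms(2,3)]
  interpret N: abelian_subgroup "tensor_null R V W" ?F by (rule F.abelian_subgroup_of_submodule[OF N])
  obtain x where x: "x \<in> carrier ?F" "t = tensor_null R V W +>\<^bsub>?F\<^esub> x"
    using assms(1) unfolding tensor_def by (rule F.quotient_carrierE[OF N])
  have "tensor_coeff t \<in> t"
    unfolding tensor_coeff_def by (rule someI[of _ x]) (simp add: x N.a_rcos_self)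
  then have "tensor_coeff t \<in> carrier ?F" using x by (simp add: N.a_elemrcos_carrier)
  then show "finite (tensor_support R t)" "tensor_support R t \<subseteq> carrier V \<times> carrier W"
    "tensor_coeff t \<in> tensor_support R t \<rightarrow> carrier R"
    by (auto simp: free_carrier_iff tensor_support_def)
qed

lemma sweedler_closed:
  assumes "t \<in> carrier (V \<boxtimes> W)"
    and b: "\<And>v w. v \<in> carrier V \<Longrightarrow> w \<in> carrier W \<Longrightarrow> b v w \<in> carrier P"
    and "module R V" "module R W" "module R P"
  shows "sweedler R P t b \<in> carrier P"
proof -
  interpret P: module R P by fact
  define A where "A = tensor_support R t"
  define p where "p = tensor_coeff t"
  note A = tensor_support[OF assms(1,3,4), folded A_def p_def]
  note A_sum = sweedler_eq_finsum[of R _ t, folded A_def p_def]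
  have bA: "z \<in> A \<Longrightarrow> b (fst z) (snd z) \<in> carrier P" for z using A(2) b by auto
  show ?thesis unfolding A_sum using A(3) bA by (intro P.finsum_closed) auto
qed

lemma sweedler_cong:
  assumes "t \<in> carrier (V \<boxtimes> W)"
    and eq: "\<And>v w. v \<in> carrier V \<Longrightarrow> w \<in> carrier W \<Longrightarrow> b v w = c v w"
    and c: "\<And>v w. v \<in> carrier V \<Longrightarrow> w \<in> carrier W \<Longrightarrow> c v w \<in> carrier P"
    and "module R V" "module R W" "module R P"
  shows "sweedler R P t b = sweedler R P t c"
proof -
  interpret P: module R P by fact
  define A where "A = tensor_support R t"
  define p where "p = tensor_coeff t"
  note A = tensor_support[OF assms(1,4,5), folded A_def p_def]
  note A_sum = sweedler_eq_finsum[of R _ t, folded A_def p_def]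
  have bA: "z \<in> A \<Longrightarrow> b (fst z) (snd z) = c (fst z) (snd z) \<and> c (fst z) (snd z) \<in> carrier P" for z
    using A(2) eq c by auto
  show ?thesis unfolding A_sum using A(1,3) bA by (intro P.finsum_cong') auto
qed

lemma linear_map_apply_sweedler:
  assumes "linear_map R P Q f" and "t \<in> carrier (V \<boxtimes> W)"
    and b: "\<And>v w. v \<in> carrier V \<Longrightarrow> w \<in> carrier W \<Longrightarrow> b v w \<in> carrier P"
    and "module R V" "module R W" "module R P" "module R Q"
  shows "f (sweedler R P t b) = sweedler R Q t (\<lambda>v w. f (b v w))"
proof -
  interpret P: module R P by fact
  interpret Q: module R Q by fact
  define A where "A = tensor_support R t"
  define p where "p = tensor_coeff t"
  note A = tensor_support[OF assms(2,4,5), folded A_def p_def]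
  note A_sum = sweedler_eq_finsum[of R _ t, folded A_def p_def]
  have bA: "z \<in> A \<Longrightarrow> b (fst z) (snd z) \<in> carrier P" for z using A(2) b by auto
  have p: "z \<in> A \<Longrightarrow> p z \<in> carrier R" for z using A(3) by auto
  show ?thesis unfolding A_sum
    by (subst linear_map_finsum[OF assms(6,7,1) A(1)])
      (use A(1) p bA linear_mapD[OF assms(1)] in \<open>auto intro!: Q.finsum_cong'\<close>)
qed

lemma linear_map_sweedler_body:
  assumes "t \<in> carrier (V \<boxtimes> W)"
    and c: "\<And>v w. v \<in> carrier V \<Longrightarrow> w \<in> carrier W \<Longrightarrow> linear_map R X P (\<lambda>x. c x v w)"
    and "module R V" "module R W" "module R P"
  shows "linear_map R X P (\<lambda>x. sweedler R P t (\<lambda>v w. c x v w))"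
proof -
  interpret P: module R P by fact
  define A where "A = tensor_support R t"
  define p where "p = tensor_coeff t"
  note A = tensor_support[OF assms(1,3,4), folded A_def p_def]
  note A_sum = sweedler_eq_finsum[of R _ t, folded A_def p_def]
  have cA: "z \<in> A \<Longrightarrow> linear_map R X P (\<lambda>x. c x (fst z) (snd z))" for z using A(2) c by auto
  note lin = linear_mapD[OF cA]
  have p: "z \<in> A \<Longrightarrow> p z \<in> carrier R" for z using A(3) by auto
  show ?thesis unfolding A_sum
  proof (rule linear_mapI)
    fix x assume x: "x \<in> carrier X"
    then show "(\<Oplus>\<^bsub>P\<^esub>z\<in>A. p z \<odot>\<^bsub>P\<^esub> c x (fst z) (snd z)) \<in> carrier P"
      using p lin(1) by (intro P.finsum_closed) auto
    fix a assume a: "a \<in> carrier R"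
    have "(\<Oplus>\<^bsub>P\<^esub>z\<in>A. p z \<odot>\<^bsub>P\<^esub> c (a \<odot>\<^bsub>X\<^esub> x) (fst z) (snd z)) =
        (\<Oplus>\<^bsub>P\<^esub>z\<in>A. a \<odot>\<^bsub>P\<^esub> (p z \<odot>\<^bsub>P\<^esub> c x (fst z) (snd z)))"
      using p lin a x
      by (intro P.finsum_cong') (auto simp: P.smult_assoc1[symmetric] m_comm)
    also have "\<dots> = a \<odot>\<^bsub>P\<^esub> (\<Oplus>\<^bsub>P\<^esub>z\<in>A. p z \<odot>\<^bsub>P\<^esub> c x (fst z) (snd z))"
      using A(1) p lin(1) a x by (intro P.finsum_smult_ldistr[symmetric]) auto
    finally show "(\<Oplus>\<^bsub>P\<^esub>z\<in>A. p z \<odot>\<^bsub>P\<^esub> c (a \<odot>\<^bsub>X\<^esub> x) (fst z) (snd z)) =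
        a \<odot>\<^bsub>P\<^esub> (\<Oplus>\<^bsub>P\<^esub>z\<in>A. p z \<odot>\<^bsub>P\<^esub> c x (fst z) (snd z))" .
  next
    fix x y assume xy: "x \<in> carrier X" "y \<in> carrier X"
    have "(\<Oplus>\<^bsub>P\<^esub>z\<in>A. p z \<odot>\<^bsub>P\<^esub> c (x \<oplus>\<^bsub>X\<^esub> y) (fst z) (snd z)) =
        (\<Oplus>\<^bsub>P\<^esub>z\<in>A. p z \<odot>\<^bsub>P\<^esub> c x (fst z) (snd z) \<oplus>\<^bsub>P\<^esub> p z \<odot>\<^bsub>P\<^esub> c y (fst z) (snd z))"
      using p lin xy by (intro P.finsum_cong') (auto simp: P.smult_r_distr)
    also have "\<dots> = (\<Oplus>\<^bsub>P\<^esub>z\<in>A. p z \<odot>\<^bsub>P\<^esub> c x (fst z) (snd z)) \<oplus>\<^bsub>P\<^esub>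
        (\<Oplus>\<^bsub>P\<^esub>z\<in>A. p z \<odot>\<^bsub>P\<^esub> c y (fst z) (snd z))"
      using p lin(1) xy by (intro P.finsum_addf) auto
    finally show "(\<Oplus>\<^bsub>P\<^esub>z\<in>A. p z \<odot>\<^bsub>P\<^esub> c (x \<oplus>\<^bsub>X\<^esub> y) (fst z) (snd z)) =
        (\<Oplus>\<^bsub>P\<^esub>z\<in>A. p z \<odot>\<^bsub>P\<^esub> c x (fst z) (snd z)) \<oplus>\<^bsub>P\<^esub>
        (\<Oplus>\<^bsub>P\<^esub>z\<in>A. p z \<odot>\<^bsub>P\<^esub> c y (fst z) (snd z))" .
  qed
qed

lemma linear_map_sweedler_arg:
  assumes "linear_map R X (V \<boxtimes> W) f" "bilinear_map R V W P b"
    and "module R V" "module R W" "module R P"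
  shows "linear_map R X P (\<lambda>x. sweedler R P (f x) b)"
  by (rule linear_map_comp[OF linear_map_sweedler[OF assms(2-5)] assms(1)])

lemma sweedler_commute:
  assumes t: "t \<in> carrier (V \<boxtimes> W)" and s: "s \<in> carrier (X \<boxtimes> Y)"
    and c: "\<And>v w x y. v \<in> carrier V \<Longrightarrow> w \<in> carrier W \<Longrightarrow> x \<in> carrier X \<Longrightarrow> y \<in> carrier Y \<Longrightarrow>
      c v w x y \<in> carrier P"
    and "module R V" "module R W" "module R X" "module R Y" "module R P"
  shows "sweedler R P t (\<lambda>v w. sweedler R P s (\<lambda>x y. c v w x y)) =
    sweedler R P s (\<lambda>x y. sweedler R P t (\<lambda>v w. c v w x y))"
proof -
  interpret P: module R P by fact
  define A where "A = tensor_support R t"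
  define p where "p = tensor_coeff t"
  note A = tensor_support[OF assms(1,4,5), folded A_def p_def]
  note A_sum = sweedler_eq_finsum[of R _ t, folded A_def p_def]
  have cA: "c (fst z) (snd z) x y \<in> carrier P" if "z \<in> A" "x \<in> carrier X" "y \<in> carrier Y" for z x y
    using that A(2) c by auto
  have p: "z \<in> A \<Longrightarrow> p z \<in> carrier R" for z using A(3) by auto
  define B where "B = tensor_support R s"
  define q where "q = tensor_coeff s"
  note B = tensor_support[OF s assms(6,7), folded B_def q_def]
  note B_sum = sweedler_eq_finsum[of R _ s, folded B_def q_def]
  have q: "z \<in> B \<Longrightarrow> q z \<in> carrier R" for z using B(3) by auto
  have cB: "c (fst z) (snd z) (fst z') (snd z') \<in> carrier P" if "z \<in> A" "z' \<in> B" for z z'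
    using that B(2) cA by auto
  have "(\<Oplus>\<^bsub>P\<^esub>z\<in>A. p z \<odot>\<^bsub>P\<^esub> (\<Oplus>\<^bsub>P\<^esub>z'\<in>B. q z' \<odot>\<^bsub>P\<^esub> c (fst z) (snd z) (fst z') (snd z'))) =
    (\<Oplus>\<^bsub>P\<^esub>z'\<in>B. q z' \<odot>\<^bsub>P\<^esub> (\<Oplus>\<^bsub>P\<^esub>z\<in>A. p z \<odot>\<^bsub>P\<^esub> c (fst z) (snd z) (fst z') (snd z')))"
    using A(1) p cB
  proof (induction A)
    case empty
    have "(\<Oplus>\<^bsub>P\<^esub>z'\<in>B. q z' \<odot>\<^bsub>P\<^esub> \<zero>\<^bsub>P\<^esub>) = (\<Oplus>\<^bsub>P\<^esub>z'\<in>B. \<zero>\<^bsub>P\<^esub>)"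
      using q by (intro P.finsum_cong') auto
    then show ?case by simp
  next
    case (insert a A)
    have cl: "(\<Oplus>\<^bsub>P\<^esub>z\<in>A. p z \<odot>\<^bsub>P\<^esub> c (fst z) (snd z) (fst z') (snd z')) \<in> carrier P" if "z' \<in> B" for z'
      using insert.prems that by (intro P.finsum_closed) auto
    have cl2: "(\<Oplus>\<^bsub>P\<^esub>z'\<in>B. q z' \<odot>\<^bsub>P\<^esub> c (fst z) (snd z) (fst z') (snd z')) \<in> carrier P"
      if "z \<in> insert a A" for z
      using insert.prems(2)[OF that] q by (intro P.finsum_closed) auto
    have "(\<Oplus>\<^bsub>P\<^esub>z'\<in>B. q z' \<odot>\<^bsub>P\<^esub> (\<Oplus>\<^bsub>P\<^esub>z\<in>insert a A. p z \<odot>\<^bsub>P\<^esub> c (fst z) (snd z) (fst z') (snd z'))) =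
        (\<Oplus>\<^bsub>P\<^esub>z'\<in>B. p a \<odot>\<^bsub>P\<^esub> (q z' \<odot>\<^bsub>P\<^esub> c (fst a) (snd a) (fst z') (snd z')) \<oplus>\<^bsub>P\<^esub>
          q z' \<odot>\<^bsub>P\<^esub> (\<Oplus>\<^bsub>P\<^esub>z\<in>A. p z \<odot>\<^bsub>P\<^esub> c (fst z) (snd z) (fst z') (snd z')))"
      using insert.prems insert.hyps q cl
      by (intro P.finsum_cong')
        (auto simp: P.finsum_insert Pi_iff P.smult_r_distr P.smult_assoc1[symmetric] m_comm)
    also have "\<dots> = (\<Oplus>\<^bsub>P\<^esub>z'\<in>B. p a \<odot>\<^bsub>P\<^esub> (q z' \<odot>\<^bsub>P\<^esub> c (fst a) (snd a) (fst z') (snd z'))) \<oplus>\<^bsub>P\<^esub>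
        (\<Oplus>\<^bsub>P\<^esub>z'\<in>B. q z' \<odot>\<^bsub>P\<^esub> (\<Oplus>\<^bsub>P\<^esub>z\<in>A. p z \<odot>\<^bsub>P\<^esub> c (fst z) (snd z) (fst z') (snd z')))"
      using insert.prems q cl by (intro P.finsum_addf) auto
    also have "(\<Oplus>\<^bsub>P\<^esub>z'\<in>B. p a \<odot>\<^bsub>P\<^esub> (q z' \<odot>\<^bsub>P\<^esub> c (fst a) (snd a) (fst z') (snd z'))) =
        p a \<odot>\<^bsub>P\<^esub> (\<Oplus>\<^bsub>P\<^esub>z'\<in>B. q z' \<odot>\<^bsub>P\<^esub> c (fst a) (snd a) (fst z') (snd z'))"
      using insert.prems q B(1) by (intro P.finsum_smult_ldistr[symmetric]) auto
    finally show ?case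
      using insert cl2 by (subst P.finsum_insert) (auto simp: Pi_iff)
  qed
  then show ?thesis unfolding A_sum B_sum .
qed

end

section \<open>Multilinear expressions\<close>

text \<open>Linearity in each of three arguments, as \<open>bilinear_map\<close> for two.\<close>

definition trilinear_map ::
  "('k, 'c) ring_scheme \<Rightarrow> ('k, 'u, 'x) module_scheme \<Rightarrow> ('k, 'v, 'y) module_scheme \<Rightarrow>
   ('k, 'w, 'z) module_scheme \<Rightarrow> ('k, 'p, 'q) module_scheme \<Rightarrow> ('u \<Rightarrow> 'v \<Rightarrow> 'w \<Rightarrow> 'p) \<Rightarrow> bool"
  where "trilinear_map K U V W P c \<longleftrightarrow>
    (\<forall>u \<in> carrier U. bilinear_map K V W P (c u)) \<and>
    (\<forall>v \<in> carrier V. \<forall>w \<in> carrier W. linear_map K U P (\<lambda>u. c u v w))"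

lemma trilinear_mapI:
  assumes "\<And>v w. v \<in> carrier V \<Longrightarrow> w \<in> carrier W \<Longrightarrow> linear_map K U P (\<lambda>u. c u v w)"
    and "\<And>u w. u \<in> carrier U \<Longrightarrow> w \<in> carrier W \<Longrightarrow> linear_map K V P (\<lambda>v. c u v w)"
    and "\<And>u v. u \<in> carrier U \<Longrightarrow> v \<in> carrier V \<Longrightarrow> linear_map K W P (\<lambda>w. c u v w)"
  shows "trilinear_map K U V W P c"
  using assms by (auto simp: trilinear_map_def bilinear_map_def)

lemma bilinear_map_comp:
  assumes "bilinear_map K U V P b"
  shows "linear_map K X U f \<Longrightarrow> v \<in> carrier V \<Longrightarrow> linear_map K X P (\<lambda>x. b (f x) v)"
    and "u \<in> carrier U \<Longrightarrow> linear_map K X V g \<Longrightarrow> linear_map K X P (\<lambda>x. b u (g x))"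
  using assms by (auto simp: bilinear_map_def intro: linear_map_comp)

lemma trilinear_map_comp:
  assumes "trilinear_map K U V W P c"
  shows "linear_map K X U f \<Longrightarrow> v \<in> carrier V \<Longrightarrow> w \<in> carrier W \<Longrightarrow>
      linear_map K X P (\<lambda>x. c (f x) v w)"
    and "u \<in> carrier U \<Longrightarrow> linear_map K X V g \<Longrightarrow> w \<in> carrier W \<Longrightarrow>
      linear_map K X P (\<lambda>x. c u (g x) w)"
    and "u \<in> carrier U \<Longrightarrow> v \<in> carrier V \<Longrightarrow> linear_map K X W h \<Longrightarrow>
      linear_map K X P (\<lambda>x. c u v (h x))"
    and "u \<in> carrier U \<Longrightarrow> v \<in> carrier V \<Longrightarrow> w \<in> carrier W \<Longrightarrow> c u v w \<in> carrier P"
  using assms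
  by (auto simp: trilinear_map_def bilinear_map_def intro: linear_map_comp linear_map_closed
      linear_map_comp[of K U P "\<lambda>u. c u v w"] linear_map_comp[of K V P "\<lambda>v. c u v w"]
      linear_map_comp[of K W P "\<lambda>w. c u v w"])

context cring begin

lemma linear_map_ptensor:
  "linear_map R X V f \<Longrightarrow> w \<in> carrier W \<Longrightarrow> module R V \<Longrightarrow> module R W \<Longrightarrow>
    linear_map R X (V \<boxtimes> W) (\<lambda>x. ptensor R V W (f x) w)"
  "v \<in> carrier V \<Longrightarrow> linear_map R X W g \<Longrightarrow> module R V \<Longrightarrow> module R W \<Longrightarrow>
    linear_map R X (V \<boxtimes> W) (\<lambda>x. ptensor R V W v (g x))"
  by (blast intro: bilinear_map_comp bilinear_map_ptensor)+

text \<open>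
  Rules that decide by the syntax of an iterated Sweedler expression whether it is linear in a
  variable, or lies in a carrier.  The variable occurs either in the tensor over which a Sweedler
  sum runs or in its summand, so at most one of the two rules for linearity of sums applies.  Repeated resolution with these rules
  and with the assumptions therefore settles such goals; facts about further maps are added to them
  below, when these maps appear.
\<close>

lemmas multilinear = linear_map_id bilinear_mapI trilinear_mapI module_tensor
  linear_map_ptensor ptensor_closed linear_map_sweedler_body linear_map_sweedler_arg
  sweedler_closed

text \<open>A linear map is applied to a Sweedler sum by applying it to the summands.\<close>

lemma apply_sweedler_eq:
  assumes "linear_map R P Q f" "t \<in> carrier (V \<boxtimes> W)"
    and "\<And>v w. v \<in> carrier V \<Longrightarrow> w \<in> carrier W \<Longrightarrow> b v w \<in> carrier P"
    and "\<And>v w. v \<in> carrier V \<Longrightarrow> w \<in> carrier W \<Longrightarrow> f (b v w) = c v w"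
    and "module R V" "module R W" "module R P" "module R Q"
  shows "f (sweedler R P t b) = sweedler R Q t c"
  by (subst linear_map_apply_sweedler[OF assms(1-3,5-8)], assumption+)
    (rule sweedler_cong[OF assms(2) _ _ assms(5,6,8)],
      use assms(3,4) linear_map_closed[OF assms(1)] in \<open>force+\<close>)

text \<open>
  The linear map on \<open>U \<otimes> (V \<otimes> W)\<close> that is induced by a trilinear map, and its values.  Applied to both
  sides of a coassociativity law, it yields the law for arbitrary trilinear expressions.
\<close>

lemma linear_map_trilinear_extend:
  assumes "trilinear_map R U V W P c" "module R U" "module R V" "module R W" "module R P"
  shows "linear_map R (U \<boxtimes> (V \<boxtimes> W)) P (\<lambda>T. sweedler R P T (\<lambda>u s. sweedler R P s (\<lambda>v w. c u v w)))"
  by (insert assms(2-5), (assumption | rule multilinear trilinear_map_comp[OF assms(1)])+)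

lemma trilinear_extend_ptensor:
  assumes "trilinear_map R U V W P c" "module R U" "module R V" "module R W" "module R P"
    and "u \<in> carrier U" "s \<in> carrier (V \<boxtimes> W)"
  shows "sweedler R P (ptensor R U (V \<boxtimes> W) u s) (\<lambda>u s. sweedler R P s (\<lambda>v w. c u v w)) =
    sweedler R P s (\<lambda>v w. c u v w)"
  by (insert assms(2-),
    (assumption | rule sweedler_ptensor multilinear trilinear_map_comp[OF assms(1)])+)

lemma trilinear_extend_ptensor2:
  assumes "trilinear_map R U V W P c" "module R U" "module R V" "module R W" "module R P"
    and "u \<in> carrier U" "v \<in> carrier V" "w \<in> carrier W"
  shows "sweedler R P (ptensor R U (V \<boxtimes> W) u (ptensor R V W v w))
      (\<lambda>u s. sweedler R P s (\<lambda>v w. c u v w)) = c u v w"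
  by (subst trilinear_extend_ptensor[OF assms(1)];
      insert assms(2-), (assumption | rule sweedler_ptensor multilinear trilinear_map_comp[OF assms(1)])+)

end

section \<open>Yetter-Drinfel'd-Long bimodules in Sweedler notation\<close>

context hopf_algebra begin

text \<open>
  Sums over the Sweedler components of the comultiplication and of the left and right coaction:
  \<open>dsum P h (\<lambda>h1 h2. \<dots>)\<close>, \<open>lsum P M m (\<lambda>x m0. \<dots>)\<close> and \<open>rsum P M m (\<lambda>m0 x. \<dots>)\<close> are the expressions in
  \<open>h\<^sub>1, h\<^sub>2\<close>, in \<open>m\<^sub>[\<^sub>-\<^sub>1\<^sub>], m\<^sub>[\<^sub>0\<^sub>]\<close> and in \<open>m\<^sub>(\<^sub>0\<^sub>), m\<^sub>(\<^sub>1\<^sub>)\<close>, with values in \<open>P\<close>.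
\<close>

abbreviation dsum where "dsum P h b \<equiv> sweedler K P (comult H h) b"
abbreviation lsum where "lsum P M m b \<equiv> sweedler K P (lcoact M m) b"
abbreviation rsum where "rsum P M m b \<equiv> sweedler K P (rcoact M m) b"

lemmas multilinear_hopf = multilinear HM.module_axioms H.m_closed
  bilinear_map_comp[OF mult_bilinear]
  linear_map_comp[OF comult_linear] linear_map_closed[OF comult_linear]

lemma dsum_mult:
  assumes b: "bilinear_map K H H P b" and P: "module K P" and "g \<in> carrier H" "h \<in> carrier H"
  shows "dsum P (g \<otimes>\<^bsub>H\<^esub> h) b =
    dsum P g (\<lambda>g1 g2. dsum P h (\<lambda>h1 h2. b (g1 \<otimes>\<^bsub>H\<^esub> h1) (g2 \<otimes>\<^bsub>H\<^esub> h2)))"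
proof -
  note f = linear_map_sweedler[OF b HM.module_axioms HM.module_axioms P]
  show ?thesis unfolding comult_mult[OF assms(3,4)]
    by (insert assms(2-),
      (assumption | rule apply_sweedler_eq[OF f] sweedler_ptensor[OF b] multilinear_hopf)+)
qed

end

context yd_long_bimodule begin

lemmas multilinear_ydl = M.module_axioms
  bilinear_map_comp[OF lact_bilinear] bilinear_map_closed[OF lact_bilinear]
  bilinear_map_comp[OF ract_bilinear] bilinear_map_closed[OF ract_bilinear]
  linear_map_comp[OF lcoact_linear] linear_map_closed[OF lcoact_linear]
  linear_map_comp[OF rcoact_linear] linear_map_closed[OF rcoact_linear]

lemmas multilinear_bimodule = multilinear_hopf multilinear_ydl

text \<open>
  The axioms, up to and including \<open>lsum_ract\<close>, with an arbitrary multilinear expression in place of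
  the tensor product of the Sweedler components.
\<close>

lemma lsum_coassoc:
  assumes c: "trilinear_map K H H M P c" and P: "module K P" and m: "m \<in> carrier M"
  shows "lsum P M m (\<lambda>x m0. dsum P x (\<lambda>x1 x2. c x1 x2 m0)) =
    lsum P M m (\<lambda>x m0. lsum P M m0 (\<lambda>y m1. c x y m1))"
proof -
  let ?f = "\<lambda>T. sweedler K P T (\<lambda>u s. sweedler K P s (\<lambda>v w. c u v w))"
  note f = linear_map_trilinear_extend[OF c HM.module_axioms HM.module_axioms M.module_axioms P]
  note fp = trilinear_extend_ptensor[OF c HM.module_axioms HM.module_axioms M.module_axioms P]
    trilinear_extend_ptensor2[OF c HM.module_axioms HM.module_axioms M.module_axioms P]
  have "?f (sweedler K (H \<boxtimes> (H \<boxtimes> M)) (lcoact M m) (\<lambda>x m0.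
        sweedler K (H \<boxtimes> (H \<boxtimes> M)) (comult H x) (\<lambda>x1 x2.
          ptensor K H (H \<boxtimes> M) x1 (ptensor K H M x2 m0)))) =
      lsum P M m (\<lambda>x m0. dsum P x (\<lambda>x1 x2. c x1 x2 m0))"
    by (insert P m, (assumption | rule apply_sweedler_eq[OF f] fp multilinear_bimodule)+)
  moreover have "?f (sweedler K (H \<boxtimes> (H \<boxtimes> M)) (lcoact M m) (\<lambda>x m0.
        ptensor K H (H \<boxtimes> M) x (lcoact M m0))) =
      lsum P M m (\<lambda>x m0. lsum P M m0 (\<lambda>y m1. c x y m1))"
    by (insert P m, (assumption | rule apply_sweedler_eq[OF f] fp multilinear_bimodule)+)
  ultimately show ?thesis using lcoact_coassoc[OF m] by simp
qed

lemma rsum_coassoc: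
  assumes c: "trilinear_map K M H H P c" and P: "module K P" and m: "m \<in> carrier M"
  shows "rsum P M m (\<lambda>m0 x. rsum P M m0 (\<lambda>m1 y. c m1 y x)) =
    rsum P M m (\<lambda>m0 x. dsum P x (\<lambda>x1 x2. c m0 x1 x2))"
proof -
  let ?f = "\<lambda>T. sweedler K P T (\<lambda>u s. sweedler K P s (\<lambda>v w. c u v w))"
  note f = linear_map_trilinear_extend[OF c M.module_axioms HM.module_axioms HM.module_axioms P]
  note fp = trilinear_extend_ptensor[OF c M.module_axioms HM.module_axioms HM.module_axioms P]
    trilinear_extend_ptensor2[OF c M.module_axioms HM.module_axioms HM.module_axioms P]
  have "?f (sweedler K (M \<boxtimes> (H \<boxtimes> H)) (rcoact M m) (\<lambda>m0 x.
        sweedler K (M \<boxtimes> (H \<boxtimes> H)) (rcoact M m0) (\<lambda>m00 y.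
          ptensor K M (H \<boxtimes> H) m00 (ptensor K H H y x)))) =
      rsum P M m (\<lambda>m0 x. rsum P M m0 (\<lambda>m1 y. c m1 y x))"
    by (insert P m, (assumption | rule apply_sweedler_eq[OF f] fp multilinear_bimodule)+)
  moreover have "?f (sweedler K (M \<boxtimes> (H \<boxtimes> H)) (rcoact M m) (\<lambda>m0 x.
        ptensor K M (H \<boxtimes> H) m0 (comult H x))) =
      rsum P M m (\<lambda>m0 x. dsum P x (\<lambda>x1 x2. c m0 x1 x2))"
    by (insert P m, (assumption | rule apply_sweedler_eq[OF f] fp multilinear_bimodule)+)
  ultimately show ?thesis using rcoact_coassoc[OF m] by simp
qed

lemma lsum_rsum:
  assumes c: "trilinear_map K H M H P c" and P: "module K P" and m: "m \<in> carrier M"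
  shows "lsum P M m (\<lambda>x m0. rsum P M m0 (\<lambda>m1 y. c x m1 y)) =
    rsum P M m (\<lambda>m0 y. lsum P M m0 (\<lambda>x m1. c x m1 y))"
proof -
  let ?f = "\<lambda>T. sweedler K P T (\<lambda>u s. sweedler K P s (\<lambda>v w. c u v w))"
  note f = linear_map_trilinear_extend[OF c HM.module_axioms M.module_axioms HM.module_axioms P]
  note fp = trilinear_extend_ptensor[OF c HM.module_axioms M.module_axioms HM.module_axioms P]
    trilinear_extend_ptensor2[OF c HM.module_axioms M.module_axioms HM.module_axioms P]
  have "?f (sweedler K (H \<boxtimes> (M \<boxtimes> H)) (lcoact M m) (\<lambda>x m0.
        ptensor K H (M \<boxtimes> H) x (rcoact M m0))) =
      lsum P M m (\<lambda>x m0. rsum P M m0 (\<lambda>m1 y. c x m1 y))"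
    by (insert P m, (assumption | rule apply_sweedler_eq[OF f] fp multilinear_bimodule)+)
  moreover have "?f (sweedler K (H \<boxtimes> (M \<boxtimes> H)) (rcoact M m) (\<lambda>m0 y.
        sweedler K (H \<boxtimes> (M \<boxtimes> H)) (lcoact M m0) (\<lambda>x m00.
          ptensor K H (M \<boxtimes> H) x (ptensor K M H m00 y)))) =
      rsum P M m (\<lambda>m0 y. lsum P M m0 (\<lambda>x m1. c x m1 y))"
    by (insert P m, (assumption | rule apply_sweedler_eq[OF f] fp multilinear_bimodule)+)
  ultimately show ?thesis using lcoact_rcoact[OF m] by simp
qed

lemma lsum_lact:
  assumes b: "bilinear_map K H M P b" and P: "module K P"
    and h: "h \<in> carrier H" and m: "m \<in> carrier M"
  shows "dsum P h (\<lambda>h1 h2. lsum P M (h1 \<triangleright>\<^bsub>M\<^esub> m) (\<lambda>x m0. b (x \<otimes>\<^bsub>H\<^esub> h2) m0)) =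
    dsum P h (\<lambda>h1 h2. lsum P M m (\<lambda>x m0. b (h1 \<otimes>\<^bsub>H\<^esub> x) (h2 \<triangleright>\<^bsub>M\<^esub> m0)))"
proof -
  note f = linear_map_sweedler[OF b HM.module_axioms M.module_axioms P]
  have "sweedler K P (sweedler K (H \<boxtimes> M) (comult H h) (\<lambda>h1 h2.
        sweedler K (H \<boxtimes> M) (lcoact M (h1 \<triangleright>\<^bsub>M\<^esub> m)) (\<lambda>x m0.
          ptensor K H M (x \<otimes>\<^bsub>H\<^esub> h2) m0))) b =
      dsum P h (\<lambda>h1 h2. lsum P M (h1 \<triangleright>\<^bsub>M\<^esub> m) (\<lambda>x m0. b (x \<otimes>\<^bsub>H\<^esub> h2) m0))"
    by (insert P h m,
      (assumption | rule apply_sweedler_eq[OF f] sweedler_ptensor[OF b] multilinear_bimodule)+)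
  moreover have "sweedler K P (sweedler K (H \<boxtimes> M) (comult H h) (\<lambda>h1 h2.
        sweedler K (H \<boxtimes> M) (lcoact M m) (\<lambda>x m0.
          ptensor K H M (h1 \<otimes>\<^bsub>H\<^esub> x) (h2 \<triangleright>\<^bsub>M\<^esub> m0)))) b =
      dsum P h (\<lambda>h1 h2. lsum P M m (\<lambda>x m0. b (h1 \<otimes>\<^bsub>H\<^esub> x) (h2 \<triangleright>\<^bsub>M\<^esub> m0)))"
    by (insert P h m,
      (assumption | rule apply_sweedler_eq[OF f] sweedler_ptensor[OF b] multilinear_bimodule)+)
  ultimately show ?thesis using lact_lcoact[OF h m] by simp
qed

lemma rsum_ract:
  assumes b: "bilinear_map K M H P b" and P: "module K P"
    and h: "h \<in> carrier H" and m: "m \<in> carrier M"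
  shows "dsum P h (\<lambda>h1 h2. rsum P M (m \<triangleleft>\<^bsub>M\<^esub> h2) (\<lambda>m0 x. b m0 (h1 \<otimes>\<^bsub>H\<^esub> x))) =
    dsum P h (\<lambda>h1 h2. rsum P M m (\<lambda>m0 x. b (m0 \<triangleleft>\<^bsub>M\<^esub> h1) (x \<otimes>\<^bsub>H\<^esub> h2)))"
proof -
  note f = linear_map_sweedler[OF b M.module_axioms HM.module_axioms P]
  have "sweedler K P (sweedler K (M \<boxtimes> H) (comult H h) (\<lambda>h1 h2.
        sweedler K (M \<boxtimes> H) (rcoact M (m \<triangleleft>\<^bsub>M\<^esub> h2)) (\<lambda>m0 x.
          ptensor K M H m0 (h1 \<otimes>\<^bsub>H\<^esub> x)))) b =
      dsum P h (\<lambda>h1 h2. rsum P M (m \<triangleleft>\<^bsub>M\<^esub> h2) (\<lambda>m0 x. b m0 (h1 \<otimes>\<^bsub>H\<^esub> x)))"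
    by (insert P h m,
      (assumption | rule apply_sweedler_eq[OF f] sweedler_ptensor[OF b] multilinear_bimodule)+)
  moreover have "sweedler K P (sweedler K (M \<boxtimes> H) (comult H h) (\<lambda>h1 h2.
        sweedler K (M \<boxtimes> H) (rcoact M m) (\<lambda>m0 x.
          ptensor K M H (m0 \<triangleleft>\<^bsub>M\<^esub> h1) (x \<otimes>\<^bsub>H\<^esub> h2)))) b =
      dsum P h (\<lambda>h1 h2. rsum P M m (\<lambda>m0 x. b (m0 \<triangleleft>\<^bsub>M\<^esub> h1) (x \<otimes>\<^bsub>H\<^esub> h2)))"
    by (insert P h m,
      (assumption | rule apply_sweedler_eq[OF f] sweedler_ptensor[OF b] multilinear_bimodule)+)
  ultimately show ?thesis using ract_rcoact[OF h m] by simp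
qed

lemma rsum_lact:
  assumes b: "bilinear_map K M H P b" and P: "module K P"
    and h: "h \<in> carrier H" and m: "m \<in> carrier M"
  shows "rsum P M (h \<triangleright>\<^bsub>M\<^esub> m) b = rsum P M m (\<lambda>m0 x. b (h \<triangleright>\<^bsub>M\<^esub> m0) x)"
proof -
  note f = linear_map_sweedler[OF b M.module_axioms HM.module_axioms P]
  show ?thesis unfolding lact_rcoact[OF h m]
    by (insert P h m,
      (assumption | rule apply_sweedler_eq[OF f] sweedler_ptensor[OF b] multilinear_bimodule)+)
qed

lemma lsum_ract:
  assumes b: "bilinear_map K H M P b" and P: "module K P"
    and h: "h \<in> carrier H" and m: "m \<in> carrier M"
  shows "lsum P M (m \<triangleleft>\<^bsub>M\<^esub> h) b = lsum P M m (\<lambda>x m0. b x (m0 \<triangleleft>\<^bsub>M\<^esub> h))"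
proof -
  note f = linear_map_sweedler[OF b HM.module_axioms M.module_axioms P]
  show ?thesis unfolding ract_lcoact[OF h m]
    by (insert P h m,
      (assumption | rule apply_sweedler_eq[OF f] sweedler_ptensor[OF b] multilinear_bimodule)+)
qed

section \<open>The two halves of the \<open>u\<close>-condition\<close>

text \<open>
  The endomorphisms \<open>m \<mapsto> m\<^sub>[\<^sub>-\<^sub>1\<^sub>] \<triangleright> m\<^sub>[\<^sub>0\<^sub>]\<close> and \<open>m \<mapsto> m\<^sub>(\<^sub>0\<^sub>) \<triangleleft> m\<^sub>(\<^sub>1\<^sub>)\<close>.  Both composites of the two are the map
  \<open>m \<mapsto> m\<^sub>[\<^sub>-\<^sub>1\<^sub>] \<triangleright> m\<^sub>[\<^sub>0\<^sub>]\<^sub>(\<^sub>0\<^sub>) \<triangleleft> m\<^sub>[\<^sub>0\<^sub>]\<^sub>(\<^sub>1\<^sub>)\<close> of the \<open>u\<close>-condition, so under this condition they are inverse to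
  each other.
\<close>

definition ltwist where "ltwist m = lsum M M m (\<lambda>x m0. x \<triangleright>\<^bsub>M\<^esub> m0)"
definition rtwist where "rtwist m = rsum M M m (\<lambda>m0 x. m0 \<triangleleft>\<^bsub>M\<^esub> x)"

lemma linear_ltwist: "linear_map K M M ltwist"
  unfolding ltwist_def[abs_def] by (assumption | rule multilinear_bimodule)+

lemma linear_rtwist: "linear_map K M M rtwist"
  unfolding rtwist_def[abs_def] by (assumption | rule multilinear_bimodule)+

lemmas multilinear_twist = multilinear_bimodule
  linear_map_comp[OF linear_ltwist] linear_map_comp[OF linear_rtwist]
  linear_map_closed[OF linear_ltwist] linear_map_closed[OF linear_rtwist]

text \<open>
  Each twist commutes with the coaction on the opposite side, because the action in it does:
  \<open>rtwist\<close> is left colinear and \<open>ltwist\<close> is right colinear.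
\<close>

lemma lsum_rtwist:
  assumes b: "bilinear_map K H M P b" and P: "module K P" and m: "m \<in> carrier M"
  shows "lsum P M (rtwist m) b = lsum P M m (\<lambda>x m0. b x (rtwist m0))"
proof -
  note b' = bilinear_map_comp[OF b] bilinear_map_closed[OF b]
  have lin: "linear_map K M P (\<lambda>z. lsum P M z b)"
    by (insert P, (assumption | rule multilinear_twist b')+)
  have "lsum P M (rtwist m) b = rsum P M m (\<lambda>m0 p. lsum P M m0 (\<lambda>x z. b x (z \<triangleleft>\<^bsub>M\<^esub> p)))"
    unfolding rtwist_def
    by (insert P m b, (assumption | rule apply_sweedler_eq[OF lin] lsum_ract multilinear_twist b')+)
  also have "\<dots> = lsum P M m (\<lambda>x m0. rsum P M m0 (\<lambda>z p. b x (z \<triangleleft>\<^bsub>M\<^esub> p)))"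
    by (insert P m, (assumption | rule lsum_rsum[symmetric] multilinear_twist b')+)
  also have "\<dots> = lsum P M m (\<lambda>x m0. b x (rtwist m0))"
    unfolding rtwist_def
    by (insert P m,
      (assumption | rule sweedler_cong apply_sweedler_eq[symmetric] refl multilinear_twist b')+)
  finally show ?thesis .
qed

lemma rsum_ltwist:
  assumes b: "bilinear_map K M H P b" and P: "module K P" and m: "m \<in> carrier M"
  shows "rsum P M (ltwist m) b = rsum P M m (\<lambda>m0 p. b (ltwist m0) p)"
proof -
  note b' = bilinear_map_comp[OF b] bilinear_map_closed[OF b]
  have lin: "linear_map K M P (\<lambda>z. rsum P M z b)"
    by (insert P, (assumption | rule multilinear_twist b')+)
  have "rsum P M (ltwist m) b = lsum P M m (\<lambda>x m0. rsum P M m0 (\<lambda>z p. b (x \<triangleright>\<^bsub>M\<^esub> z) p))"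
    unfolding ltwist_def
    by (insert P m b, (assumption | rule apply_sweedler_eq[OF lin] rsum_lact multilinear_twist b')+)
  also have "\<dots> = rsum P M m (\<lambda>m0 p. lsum P M m0 (\<lambda>x z. b (x \<triangleright>\<^bsub>M\<^esub> z) p))"
    by (insert P m, (assumption | rule lsum_rsum multilinear_twist b')+)
  also have "\<dots> = rsum P M m (\<lambda>m0 p. b (ltwist m0) p)"
    unfolding ltwist_def
    by (insert P m,
      (assumption | rule sweedler_cong apply_sweedler_eq[symmetric] refl multilinear_twist b')+)
  finally show ?thesis .
qed

end

text \<open>Yetter-Drinfel'd-Long bimodules that satisfy the \<open>u\<close>-condition.\<close>

locale u_bimodule = yd_long_bimodule +
  assumes u: "u_condition K M"
begin

lemma ltwist_rtwist:
  assumes m: "m \<in> carrier M" shows "ltwist (rtwist m) = m"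
proof -
  have "ltwist (rtwist m) = lsum M M m (\<lambda>x m0. x \<triangleright>\<^bsub>M\<^esub> rtwist m0)"
    unfolding ltwist_def
    by (insert m, (assumption | rule lsum_rtwist lact_bilinear multilinear_twist)+)
  also have "\<dots> = lsum M M m (\<lambda>x m0. rsum M M m0 (\<lambda>z p. x \<triangleright>\<^bsub>M\<^esub> (z \<triangleleft>\<^bsub>M\<^esub> p)))"
    unfolding rtwist_def
    by (insert m, (assumption | rule sweedler_cong apply_sweedler_eq refl multilinear_twist)+)
  also have "\<dots> = lsum M M m (\<lambda>x m0. rsum M M m0 (\<lambda>z p. (x \<triangleright>\<^bsub>M\<^esub> z) \<triangleleft>\<^bsub>M\<^esub> p))"
    by (insert m, (assumption | rule sweedler_cong lact_ract[symmetric] multilinear_twist)+)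
  also have "\<dots> = m" using u m by (simp add: u_condition_def)
  finally show ?thesis .
qed

lemma rtwist_ltwist:
  assumes m: "m \<in> carrier M" shows "rtwist (ltwist m) = m"
proof -
  have "rtwist (ltwist m) = rsum M M m (\<lambda>m0 p. ltwist m0 \<triangleleft>\<^bsub>M\<^esub> p)"
    unfolding rtwist_def
    by (insert m, (assumption | rule rsum_ltwist ract_bilinear multilinear_twist)+)
  also have "\<dots> = rsum M M m (\<lambda>m0 p. lsum M M m0 (\<lambda>x z. (x \<triangleright>\<^bsub>M\<^esub> z) \<triangleleft>\<^bsub>M\<^esub> p))"
    unfolding ltwist_def
    by (insert m, (assumption | rule sweedler_cong apply_sweedler_eq refl multilinear_twist)+)
  also have "\<dots> = lsum M M m (\<lambda>x m0. rsum M M m0 (\<lambda>z p. (x \<triangleright>\<^bsub>M\<^esub> z) \<triangleleft>\<^bsub>M\<^esub> p))"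
    by (insert m, (assumption | rule lsum_rsum[symmetric] multilinear_twist)+)
  also have "\<dots> = m" using u m by (simp add: u_condition_def)
  finally show ?thesis .
qed

text \<open>
  The inverse of a bijective colinear map is colinear.  Hence each twist is colinear on its own side
  as well, being the inverse of the other one.
\<close>

lemma lsum_ltwist:
  assumes b: "bilinear_map K H M P b" and P: "module K P" and m: "m \<in> carrier M"
  shows "lsum P M (ltwist m) b = lsum P M m (\<lambda>x m0. b x (ltwist m0))"
proof -
  note b' = bilinear_map_comp[OF b] bilinear_map_closed[OF b]
  have "lsum P M (ltwist m) b = lsum P M (ltwist m) (\<lambda>x m0. b x (ltwist (rtwist m0)))"
    by (insert P m,
      (assumption | rule sweedler_cong arg_cong[of _ _ "b _"] ltwist_rtwist[symmetric] multilinear_twist b')+)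
  also have "\<dots> = lsum P M (rtwist (ltwist m)) (\<lambda>x m0. b x (ltwist m0))"
    by (insert P m, (assumption | rule lsum_rtwist[symmetric] multilinear_twist b')+)
  finally show ?thesis by (simp add: rtwist_ltwist[OF m])
qed

lemma rsum_rtwist:
  assumes b: "bilinear_map K M H P b" and P: "module K P" and m: "m \<in> carrier M"
  shows "rsum P M (rtwist m) b = rsum P M m (\<lambda>m0 p. b (rtwist m0) p)"
proof -
  note b' = bilinear_map_comp[OF b] bilinear_map_closed[OF b]
  have "rsum P M (rtwist m) b = rsum P M (rtwist m) (\<lambda>m0 p. b (rtwist (ltwist m0)) p)"
    by (insert P m,
      (assumption | rule sweedler_cong arg_cong[of _ _ "\<lambda>x. b x _"] rtwist_ltwist[symmetric] multilinear_twist b')+)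
  also have "\<dots> = rsum P M (ltwist (rtwist m)) (\<lambda>m0 p. b (rtwist m0) p)"
    by (insert P m, (assumption | rule rsum_ltwist[symmetric] multilinear_twist b')+)
  finally show ?thesis by (simp add: ltwist_rtwist[OF m])
qed

text \<open>
  An element of \<open>H\<close> that is split off a coaction and acts on the same component can be absorbed into
  a twist of the argument.
\<close>

lemma lsum_absorb:
  assumes b: "bilinear_map K H M P b" and P: "module K P" and m: "m \<in> carrier M"
  shows "lsum P M m (\<lambda>x m0. dsum P x (\<lambda>x1 x2. b x1 (x2 \<triangleright>\<^bsub>M\<^esub> m0))) = lsum P M (ltwist m) b"
proof -
  note b' = bilinear_map_comp[OF b] bilinear_map_closed[OF b]
  have "lsum P M m (\<lambda>x m0. dsum P x (\<lambda>x1 x2. b x1 (x2 \<triangleright>\<^bsub>M\<^esub> m0))) =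
      lsum P M m (\<lambda>x m0. lsum P M m0 (\<lambda>y m1. b x (y \<triangleright>\<^bsub>M\<^esub> m1)))"
    by (insert P m, (assumption | rule lsum_coassoc multilinear_twist b')+)
  also have "\<dots> = lsum P M m (\<lambda>x m0. b x (ltwist m0))"
    unfolding ltwist_def
    by (insert P m,
      (assumption | rule sweedler_cong apply_sweedler_eq[symmetric] refl multilinear_twist b')+)
  also have "\<dots> = lsum P M (ltwist m) b"
    by (insert P m, (assumption | rule lsum_ltwist[OF b, symmetric])+)
  finally show ?thesis .
qed

lemma rsum_absorb:
  assumes b: "bilinear_map K M H P b" and P: "module K P" and m: "m \<in> carrier M"
  shows "rsum P M m (\<lambda>m0 p. dsum P p (\<lambda>p1 p2. b (m0 \<triangleleft>\<^bsub>M\<^esub> p1) p2)) = rsum P M (rtwist m) b"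
proof -
  note b' = bilinear_map_comp[OF b] bilinear_map_closed[OF b]
  have "rsum P M m (\<lambda>m0 p. dsum P p (\<lambda>p1 p2. b (m0 \<triangleleft>\<^bsub>M\<^esub> p1) p2)) =
      rsum P M m (\<lambda>m0 p. rsum P M m0 (\<lambda>m1 q. b (m1 \<triangleleft>\<^bsub>M\<^esub> q) p))"
    by (insert P m, (assumption | rule rsum_coassoc[symmetric] multilinear_twist b')+)
  also have "\<dots> = rsum P M m (\<lambda>m0 p. b (rtwist m0) p)"
    unfolding rtwist_def
    by (insert P m,
      (assumption | rule sweedler_cong apply_sweedler_eq[symmetric] refl multilinear_twist b')+)
  also have "\<dots> = rsum P M (rtwist m) b"
    by (insert P m, (assumption | rule rsum_rtwist[OF b, symmetric])+)
  finally show ?thesis .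
qed

text \<open>The same with the two coactions combined.\<close>

lemma lsum_rsum_absorb_left:
  assumes c: "trilinear_map K H M H P c" and P: "module K P" and m: "m \<in> carrier M"
  shows "lsum P M m (\<lambda>x m0. rsum P M m0 (\<lambda>m1 p. dsum P x (\<lambda>x1 x2. c x1 (x2 \<triangleright>\<^bsub>M\<^esub> m1) p))) =
    lsum P M (ltwist m) (\<lambda>x m0. rsum P M m0 (\<lambda>m1 p. c x m1 p))"
proof -
  note c' = trilinear_map_comp[OF c]
  let ?b = "\<lambda>x m0. rsum P M m0 (\<lambda>m1 p. c x m1 p)"
  have "lsum P M m (\<lambda>x m0. rsum P M m0 (\<lambda>m1 p. dsum P x (\<lambda>x1 x2. c x1 (x2 \<triangleright>\<^bsub>M\<^esub> m1) p))) =
      lsum P M m (\<lambda>x m0. dsum P x (\<lambda>x1 x2. rsum P M m0 (\<lambda>m1 p. c x1 (x2 \<triangleright>\<^bsub>M\<^esub> m1) p)))"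
    by (insert P m, (assumption | rule sweedler_commute sweedler_cong multilinear_twist c')+)
  also have "\<dots> = lsum P M m (\<lambda>x m0. dsum P x (\<lambda>x1 x2. ?b x1 (x2 \<triangleright>\<^bsub>M\<^esub> m0)))"
    by (insert P m, (assumption | rule rsum_lact[symmetric] sweedler_cong multilinear_twist c')+)
  also have "\<dots> = lsum P M (ltwist m) ?b"
    by (rule lsum_absorb; insert P m, (assumption | rule multilinear_twist c')+)
  finally show ?thesis .
qed

lemma lsum_rsum_absorb_right:
  assumes c: "trilinear_map K H M H P c" and P: "module K P" and m: "m \<in> carrier M"
  shows "lsum P M m (\<lambda>x m0. rsum P M m0 (\<lambda>m1 p. dsum P p (\<lambda>p1 p2. c x (m1 \<triangleleft>\<^bsub>M\<^esub> p1) p2))) =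
    lsum P M (rtwist m) (\<lambda>x m0. rsum P M m0 (\<lambda>m1 p. c x m1 p))"
proof -
  note c' = trilinear_map_comp[OF c]
  have "lsum P M m (\<lambda>x m0. rsum P M m0 (\<lambda>m1 p. dsum P p (\<lambda>p1 p2. c x (m1 \<triangleleft>\<^bsub>M\<^esub> p1) p2))) =
      lsum P M m (\<lambda>x m0. rsum P M (rtwist m0) (\<lambda>m1 p. c x m1 p))"
    by (rule sweedler_cong, (insert P m, (assumption | rule rsum_absorb multilinear_twist c')+))
  also have "\<dots> = lsum P M (rtwist m) (\<lambda>x m0. rsum P M m0 (\<lambda>m1 p. c x m1 p))"
    by (insert P m, (assumption | rule lsum_rtwist[symmetric] multilinear_twist c')+)
  finally show ?thesis .
qed

lemma rtwist_lact:
  assumes h: "h \<in> carrier H" and m: "m \<in> carrier M"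
  shows "rtwist (h \<triangleright>\<^bsub>M\<^esub> m) = h \<triangleright>\<^bsub>M\<^esub> rtwist m"
proof -
  have "rtwist (h \<triangleright>\<^bsub>M\<^esub> m) = rsum M M m (\<lambda>m0 p. (h \<triangleright>\<^bsub>M\<^esub> m0) \<triangleleft>\<^bsub>M\<^esub> p)"
    unfolding rtwist_def by (insert h m, (assumption | rule rsum_lact ract_bilinear multilinear_twist)+)
  also have "\<dots> = h \<triangleright>\<^bsub>M\<^esub> rtwist m"
    unfolding rtwist_def
    by (insert h m,
      (assumption | rule apply_sweedler_eq[symmetric] lact_ract[symmetric] multilinear_twist)+)
  finally show ?thesis .
qed

end

section \<open>The square of the braiding\<close>

text \<open>Two bimodules over the same Hopf algebra, both subject to the \<open>u\<close>-condition.\<close>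

locale u_pair = M?: u_bimodule K H M + N: u_bimodule K H N
  for K (structure) and H :: "('k, 'h, 'z) hopf_scheme"
    and M :: "('k, 'h, 'm, 'x) ydl_scheme" and N :: "('k, 'h, 'n, 'y) ydl_scheme"
begin

text \<open>The underlying vector space of the tensor product of the two bimodules, and its pure tensors.\<close>

abbreviation "T \<equiv> M \<boxtimes> N"
abbreviation "pt \<equiv> ptensor K M N"

lemmas multilinear_pair = M.multilinear_twist N.multilinear_ydl
  linear_map_comp[OF N.linear_ltwist] linear_map_comp[OF N.linear_rtwist]
  linear_map_closed[OF N.linear_ltwist] linear_map_closed[OF N.linear_rtwist]

text \<open>
  Proves that two iterated Sweedler sums are equal if they differ by exchanges of adjacent sums: on
  each level, the two sums are exchanged if the outer ones differ, and else the summands are compared.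
\<close>

lemmas sweedler_reorder = sweedler_commute sweedler_cong refl

lemma braiding_braiding_ptensor:
  assumes m: "m \<in> carrier M" and n: "n \<in> carrier N"
  shows "braiding K N M (braiding K M N (pt m n)) =
    lsum T M m (\<lambda>x m0. lsum T N (x \<triangleright>\<^bsub>N\<^esub> n) (\<lambda>y n0. rsum T N n0 (\<lambda>n1 q.
      rsum T M (m0 \<triangleleft>\<^bsub>M\<^esub> q) (\<lambda>m1 p. pt (y \<triangleright>\<^bsub>M\<^esub> m1) (n1 \<triangleleft>\<^bsub>N\<^esub> p)))))"
proof -
  let ?b = "\<lambda>n m. lsum T N n (\<lambda>x n0. rsum T M m (\<lambda>m0 y. pt (x \<triangleright>\<^bsub>M\<^esub> m0) (n0 \<triangleleft>\<^bsub>N\<^esub> y)))"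
  have lin: "linear_map K (N \<boxtimes> M) T (\<lambda>t. sweedler K T t ?b)"
    by (assumption | rule multilinear_pair)+
  have "braiding K M N (pt m n) = lsum (N \<boxtimes> M) M m (\<lambda>x m0. rsum (N \<boxtimes> M) N n (\<lambda>n0 y.
      ptensor K N M (x \<triangleright>\<^bsub>N\<^esub> n0) (m0 \<triangleleft>\<^bsub>M\<^esub> y)))"
    unfolding braiding_def
    by (rule sweedler_ptensor; insert m n, (assumption | rule multilinear_pair)+)
  then have "braiding K N M (braiding K M N (pt m n)) =
      sweedler K T (lsum (N \<boxtimes> M) M m (\<lambda>x m0. rsum (N \<boxtimes> M) N n (\<lambda>n0 y.
      ptensor K N M (x \<triangleright>\<^bsub>N\<^esub> n0) (m0 \<triangleleft>\<^bsub>M\<^esub> y)))) ?b"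
    by (simp add: braiding_def)
  also have "\<dots> = lsum T M m (\<lambda>x m0. rsum T N n (\<lambda>n0 q. ?b (x \<triangleright>\<^bsub>N\<^esub> n0) (m0 \<triangleleft>\<^bsub>M\<^esub> q)))"
    by (insert m n,
      (assumption | rule apply_sweedler_eq[OF lin] sweedler_ptensor multilinear_pair)+)
  also have "\<dots> = lsum T M m (\<lambda>x m0. rsum T N (x \<triangleright>\<^bsub>N\<^esub> n) (\<lambda>n0 q. ?b n0 (m0 \<triangleleft>\<^bsub>M\<^esub> q)))"
    by (rule sweedler_cong, (insert m n,
      (assumption | rule N.rsum_lact[symmetric] multilinear_pair)+))
  also have "\<dots> = lsum T M m (\<lambda>x m0. lsum T N (x \<triangleright>\<^bsub>N\<^esub> n) (\<lambda>y n0. rsum T N n0 (\<lambda>n1 q.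
      rsum T M (m0 \<triangleleft>\<^bsub>M\<^esub> q) (\<lambda>m1 p. pt (y \<triangleright>\<^bsub>M\<^esub> m1) (n1 \<triangleleft>\<^bsub>N\<^esub> p)))))"
    by (rule sweedler_cong, (insert m n,
      (assumption | rule N.lsum_rsum[symmetric] multilinear_pair)+))
  finally show ?thesis .
qed

text \<open>
  The left side is the map of the \<open>u\<close>-condition for the tensor product (\<open>u_map_ptensor\<close>), the right
  side is the squared braiding (\<open>braiding_braiding_ptensor\<close>), both at \<open>m \<otimes> n\<close>.  The components of \<open>m\<close> and \<open>n\<close> that act on their own origin are first
  absorbed into \<open>rtwist m\<close> and \<open>ltwist n\<close>.  Then the left compatibility of \<open>N\<close> and the right
  compatibility of \<open>M\<close> are used, and the remaining inner components undo the two twists.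
\<close>

lemma u_expression_eq_braidings:
  assumes m: "m \<in> carrier M" and n: "n \<in> carrier N"
  shows "lsum T M m (\<lambda>x m0. lsum T N n (\<lambda>y n0. rsum T M m0 (\<lambda>m1 p. rsum T N n0 (\<lambda>n1 q.
      dsum T (x \<otimes>\<^bsub>H\<^esub> y) (\<lambda>h1 h2. dsum T (p \<otimes>\<^bsub>H\<^esub> q) (\<lambda>k1 k2.
        pt ((h1 \<triangleright>\<^bsub>M\<^esub> m1) \<triangleleft>\<^bsub>M\<^esub> k1) ((h2 \<triangleright>\<^bsub>N\<^esub> n1) \<triangleleft>\<^bsub>N\<^esub> k2))))))) =
    lsum T M m (\<lambda>x m0. lsum T N (x \<triangleright>\<^bsub>N\<^esub> n) (\<lambda>y n0. rsum T N n0 (\<lambda>n1 q.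
      rsum T M (m0 \<triangleleft>\<^bsub>M\<^esub> q) (\<lambda>m1 p. pt (y \<triangleright>\<^bsub>M\<^esub> m1) (n1 \<triangleleft>\<^bsub>N\<^esub> p)))))" (is "?U = ?V")
proof -
  let ?X = "M.rtwist m" and ?Y = "N.ltwist n"
  have X: "?X \<in> carrier M" and Y: "?Y \<in> carrier N" by (insert m n, (assumption | rule multilinear_pair)+)
  \<comment> \<open>comultiplicativity splits each of the four coaction components in two\<close>
  have s1: "dsum T (x \<otimes>\<^bsub>H\<^esub> y) (\<lambda>h1 h2. dsum T (p \<otimes>\<^bsub>H\<^esub> q) (\<lambda>k1 k2.
        pt ((h1 \<triangleright>\<^bsub>M\<^esub> m1) \<triangleleft>\<^bsub>M\<^esub> k1) ((h2 \<triangleright>\<^bsub>N\<^esub> n1) \<triangleleft>\<^bsub>N\<^esub> k2))) =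
      dsum T p (\<lambda>p1 p2. dsum T y (\<lambda>y1 y2. dsum T x (\<lambda>x1 x2. dsum T q (\<lambda>q1 q2.
        pt ((x1 \<otimes>\<^bsub>H\<^esub> y1) \<triangleright>\<^bsub>M\<^esub> ((m1 \<triangleleft>\<^bsub>M\<^esub> p1) \<triangleleft>\<^bsub>M\<^esub> q1))
          ((x2 \<triangleright>\<^bsub>N\<^esub> (y2 \<triangleright>\<^bsub>N\<^esub> n1)) \<triangleleft>\<^bsub>N\<^esub> (p2 \<otimes>\<^bsub>H\<^esub> q2))))))"
    if "x \<in> carrier H" "y \<in> carrier H" "p \<in> carrier H" "q \<in> carrier H"
      "m1 \<in> carrier M" "n1 \<in> carrier N" for x y p q m1 n1
  proof -
    have "dsum T (x \<otimes>\<^bsub>H\<^esub> y) (\<lambda>h1 h2. dsum T (p \<otimes>\<^bsub>H\<^esub> q) (\<lambda>k1 k2.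
        pt ((h1 \<triangleright>\<^bsub>M\<^esub> m1) \<triangleleft>\<^bsub>M\<^esub> k1) ((h2 \<triangleright>\<^bsub>N\<^esub> n1) \<triangleleft>\<^bsub>N\<^esub> k2))) =
      dsum T (p \<otimes>\<^bsub>H\<^esub> q) (\<lambda>k1 k2. dsum T (x \<otimes>\<^bsub>H\<^esub> y) (\<lambda>h1 h2.
        pt ((h1 \<triangleright>\<^bsub>M\<^esub> m1) \<triangleleft>\<^bsub>M\<^esub> k1) ((h2 \<triangleright>\<^bsub>N\<^esub> n1) \<triangleleft>\<^bsub>N\<^esub> k2)))"
      by (insert that, (assumption | rule sweedler_commute multilinear_pair)+)
    also have "\<dots> = dsum T p (\<lambda>p1 p2. dsum T q (\<lambda>q1 q2. dsum T (x \<otimes>\<^bsub>H\<^esub> y) (\<lambda>h1 h2.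
        pt ((h1 \<triangleright>\<^bsub>M\<^esub> m1) \<triangleleft>\<^bsub>M\<^esub> (p1 \<otimes>\<^bsub>H\<^esub> q1)) ((h2 \<triangleright>\<^bsub>N\<^esub> n1) \<triangleleft>\<^bsub>N\<^esub> (p2 \<otimes>\<^bsub>H\<^esub> q2)))))"
      by (insert that, (assumption | rule dsum_mult multilinear_pair)+)
    also have "\<dots> = dsum T p (\<lambda>p1 p2. dsum T (x \<otimes>\<^bsub>H\<^esub> y) (\<lambda>h1 h2. dsum T q (\<lambda>q1 q2.
        pt ((h1 \<triangleright>\<^bsub>M\<^esub> m1) \<triangleleft>\<^bsub>M\<^esub> (p1 \<otimes>\<^bsub>H\<^esub> q1)) ((h2 \<triangleright>\<^bsub>N\<^esub> n1) \<triangleleft>\<^bsub>N\<^esub> (p2 \<otimes>\<^bsub>H\<^esub> q2)))))"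
      by (rule sweedler_cong, (insert that, (assumption | rule sweedler_commute multilinear_pair)+))
    also have "\<dots> = dsum T p (\<lambda>p1 p2. dsum T x (\<lambda>x1 x2. dsum T y (\<lambda>y1 y2. dsum T q (\<lambda>q1 q2.
        pt (((x1 \<otimes>\<^bsub>H\<^esub> y1) \<triangleright>\<^bsub>M\<^esub> m1) \<triangleleft>\<^bsub>M\<^esub> (p1 \<otimes>\<^bsub>H\<^esub> q1))
          (((x2 \<otimes>\<^bsub>H\<^esub> y2) \<triangleright>\<^bsub>N\<^esub> n1) \<triangleleft>\<^bsub>N\<^esub> (p2 \<otimes>\<^bsub>H\<^esub> q2))))))"
      by (rule sweedler_cong, (insert that, (assumption | rule dsum_mult multilinear_pair)+))
    also have "\<dots> = dsum T p (\<lambda>p1 p2. dsum T y (\<lambda>y1 y2. dsum T x (\<lambda>x1 x2. dsum T q (\<lambda>q1 q2.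
        pt (((x1 \<otimes>\<^bsub>H\<^esub> y1) \<triangleright>\<^bsub>M\<^esub> m1) \<triangleleft>\<^bsub>M\<^esub> (p1 \<otimes>\<^bsub>H\<^esub> q1))
          (((x2 \<otimes>\<^bsub>H\<^esub> y2) \<triangleright>\<^bsub>N\<^esub> n1) \<triangleleft>\<^bsub>N\<^esub> (p2 \<otimes>\<^bsub>H\<^esub> q2))))))"
      by (rule sweedler_cong, (insert that, (assumption | rule sweedler_commute multilinear_pair)+))
    also have "\<dots> = dsum T p (\<lambda>p1 p2. dsum T y (\<lambda>y1 y2. dsum T x (\<lambda>x1 x2. dsum T q (\<lambda>q1 q2.
        pt ((x1 \<otimes>\<^bsub>H\<^esub> y1) \<triangleright>\<^bsub>M\<^esub> ((m1 \<triangleleft>\<^bsub>M\<^esub> p1) \<triangleleft>\<^bsub>M\<^esub> q1))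
          ((x2 \<triangleright>\<^bsub>N\<^esub> (y2 \<triangleright>\<^bsub>N\<^esub> n1)) \<triangleleft>\<^bsub>N\<^esub> (p2 \<otimes>\<^bsub>H\<^esub> q2))))))"
    proof -
      have *: "pt (((x1 \<otimes>\<^bsub>H\<^esub> y1) \<triangleright>\<^bsub>M\<^esub> m1) \<triangleleft>\<^bsub>M\<^esub> (p1 \<otimes>\<^bsub>H\<^esub> q1))
          (((x2 \<otimes>\<^bsub>H\<^esub> y2) \<triangleright>\<^bsub>N\<^esub> n1) \<triangleleft>\<^bsub>N\<^esub> (p2 \<otimes>\<^bsub>H\<^esub> q2)) =
          pt ((x1 \<otimes>\<^bsub>H\<^esub> y1) \<triangleright>\<^bsub>M\<^esub> ((m1 \<triangleleft>\<^bsub>M\<^esub> p1) \<triangleleft>\<^bsub>M\<^esub> q1))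
          ((x2 \<triangleright>\<^bsub>N\<^esub> (y2 \<triangleright>\<^bsub>N\<^esub> n1)) \<triangleleft>\<^bsub>N\<^esub> (p2 \<otimes>\<^bsub>H\<^esub> q2))"
        if "x1 \<in> carrier H" "x2 \<in> carrier H" "y1 \<in> carrier H" "y2 \<in> carrier H" "p1 \<in> carrier H"
          "p2 \<in> carrier H" "q1 \<in> carrier H" "q2 \<in> carrier H" for x1 x2 y1 y2 p1 p2 q1 q2
        using that \<open>m1 \<in> carrier M\<close> \<open>n1 \<in> carrier N\<close>
        by (simp add: M.lact_ract M.ract_mult N.lact_mult bilinear_map_closed[OF M.ract_bilinear])
      show ?thesis by (insert that, (assumption | rule * sweedler_cong multilinear_pair)+)
    qed
    finally show ?thesis .
  qed
  have "?U = lsum T M m (\<lambda>x m0. lsum T N n (\<lambda>y n0. rsum T M m0 (\<lambda>m1 p. rsum T N n0 (\<lambda>n1 q.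
      dsum T p (\<lambda>p1 p2. dsum T y (\<lambda>y1 y2. dsum T x (\<lambda>x1 x2. dsum T q (\<lambda>q1 q2.
        pt ((x1 \<otimes>\<^bsub>H\<^esub> y1) \<triangleright>\<^bsub>M\<^esub> ((m1 \<triangleleft>\<^bsub>M\<^esub> p1) \<triangleleft>\<^bsub>M\<^esub> q1))
          ((x2 \<triangleright>\<^bsub>N\<^esub> (y2 \<triangleright>\<^bsub>N\<^esub> n1)) \<triangleleft>\<^bsub>N\<^esub> (p2 \<otimes>\<^bsub>H\<^esub> q2))))))))))"
    by (insert m n, (assumption | rule s1 sweedler_cong multilinear_pair)+)
  also have "\<dots> = lsum T M m (\<lambda>x m0. rsum T M m0 (\<lambda>m1 p. lsum T N n (\<lambda>y n0.
      dsum T p (\<lambda>p1 p2. rsum T N n0 (\<lambda>n1 q. dsum T y (\<lambda>y1 y2. dsum T x (\<lambda>x1 x2. dsum T q (\<lambda>q1 q2.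
        pt ((x1 \<otimes>\<^bsub>H\<^esub> y1) \<triangleright>\<^bsub>M\<^esub> ((m1 \<triangleleft>\<^bsub>M\<^esub> p1) \<triangleleft>\<^bsub>M\<^esub> q1))
          ((x2 \<triangleright>\<^bsub>N\<^esub> (y2 \<triangleright>\<^bsub>N\<^esub> n1)) \<triangleleft>\<^bsub>N\<^esub> (p2 \<otimes>\<^bsub>H\<^esub> q2))))))))))"
    by (rule trans, rule sweedler_cong, (insert m n,
      (assumption | rule sweedler_commute multilinear_pair)+),
      (assumption | rule sweedler_reorder multilinear_pair)+)
  also have "\<dots> = lsum T M m (\<lambda>x m0. rsum T M m0 (\<lambda>m1 p. dsum T p (\<lambda>p1 p2. lsum T N n (\<lambda>y n0.
      rsum T N n0 (\<lambda>n1 q. dsum T y (\<lambda>y1 y2. dsum T x (\<lambda>x1 x2. dsum T q (\<lambda>q1 q2.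
        pt ((x1 \<otimes>\<^bsub>H\<^esub> y1) \<triangleright>\<^bsub>M\<^esub> ((m1 \<triangleleft>\<^bsub>M\<^esub> p1) \<triangleleft>\<^bsub>M\<^esub> q1))
          ((x2 \<triangleright>\<^bsub>N\<^esub> (y2 \<triangleright>\<^bsub>N\<^esub> n1)) \<triangleleft>\<^bsub>N\<^esub> (p2 \<otimes>\<^bsub>H\<^esub> q2))))))))))"
    by (insert m n, (assumption | rule sweedler_reorder multilinear_pair)+)
  \<comment> \<open>\<open>y2\<close> acts from the left on \<open>n1\<close>: absorb it\<close>
  also have "\<dots> = lsum T M m (\<lambda>x m0. rsum T M m0 (\<lambda>m1 p. dsum T p (\<lambda>p1 p2. lsum T N ?Y (\<lambda>y n0.
      rsum T N n0 (\<lambda>n1 q. dsum T x (\<lambda>x1 x2. dsum T q (\<lambda>q1 q2.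
        pt ((x1 \<otimes>\<^bsub>H\<^esub> y) \<triangleright>\<^bsub>M\<^esub> ((m1 \<triangleleft>\<^bsub>M\<^esub> p1) \<triangleleft>\<^bsub>M\<^esub> q1))
          ((x2 \<triangleright>\<^bsub>N\<^esub> n1) \<triangleleft>\<^bsub>N\<^esub> (p2 \<otimes>\<^bsub>H\<^esub> q2)))))))))"
  proof -
    have *: "lsum T N n (\<lambda>y n0. rsum T N n0 (\<lambda>n1 q. dsum T y (\<lambda>y1 y2. dsum T x (\<lambda>x1 x2. dsum T q (\<lambda>q1 q2.
        pt ((x1 \<otimes>\<^bsub>H\<^esub> y1) \<triangleright>\<^bsub>M\<^esub> (m1 \<triangleleft>\<^bsub>M\<^esub> q1))
          ((x2 \<triangleright>\<^bsub>N\<^esub> (y2 \<triangleright>\<^bsub>N\<^esub> n1)) \<triangleleft>\<^bsub>N\<^esub> (p2 \<otimes>\<^bsub>H\<^esub> q2))))))) =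
      lsum T N ?Y (\<lambda>y n0. rsum T N n0 (\<lambda>n1 q. dsum T x (\<lambda>x1 x2. dsum T q (\<lambda>q1 q2.
        pt ((x1 \<otimes>\<^bsub>H\<^esub> y) \<triangleright>\<^bsub>M\<^esub> (m1 \<triangleleft>\<^bsub>M\<^esub> q1))
          ((x2 \<triangleright>\<^bsub>N\<^esub> n1) \<triangleleft>\<^bsub>N\<^esub> (p2 \<otimes>\<^bsub>H\<^esub> q2))))))"
      if "x \<in> carrier H" "m1 \<in> carrier M" "p2 \<in> carrier H" for x m1 p2
      by (rule N.lsum_rsum_absorb_left[where c="\<lambda>y n1 q. dsum T x (\<lambda>x1 x2. dsum T q (\<lambda>q1 q2.
        pt ((x1 \<otimes>\<^bsub>H\<^esub> y) \<triangleright>\<^bsub>M\<^esub> (m1 \<triangleleft>\<^bsub>M\<^esub> q1))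
          ((x2 \<triangleright>\<^bsub>N\<^esub> n1) \<triangleleft>\<^bsub>N\<^esub> (p2 \<otimes>\<^bsub>H\<^esub> q2))))"]; insert that n, (assumption | rule multilinear_pair)+)
    show ?thesis by (insert m n, (assumption | rule * sweedler_cong multilinear_pair)+)
  qed
  \<comment> \<open>\<open>p1\<close> acts from the right on \<open>m1\<close>: absorb it\<close>
  also have "\<dots> = lsum T M ?X (\<lambda>x m0. rsum T M m0 (\<lambda>m1 p. lsum T N ?Y (\<lambda>y n0.
      rsum T N n0 (\<lambda>n1 q. dsum T x (\<lambda>x1 x2. dsum T q (\<lambda>q1 q2.
        pt ((x1 \<otimes>\<^bsub>H\<^esub> y) \<triangleright>\<^bsub>M\<^esub> (m1 \<triangleleft>\<^bsub>M\<^esub> q1))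
          ((x2 \<triangleright>\<^bsub>N\<^esub> n1) \<triangleleft>\<^bsub>N\<^esub> (p \<otimes>\<^bsub>H\<^esub> q2))))))))"
    by (rule M.lsum_rsum_absorb_right[where c="\<lambda>x m1 p. lsum T N ?Y (\<lambda>y n0.
      rsum T N n0 (\<lambda>n1 q. dsum T x (\<lambda>x1 x2. dsum T q (\<lambda>q1 q2.
        pt ((x1 \<otimes>\<^bsub>H\<^esub> y) \<triangleright>\<^bsub>M\<^esub> (m1 \<triangleleft>\<^bsub>M\<^esub> q1))
          ((x2 \<triangleright>\<^bsub>N\<^esub> n1) \<triangleleft>\<^bsub>N\<^esub> (p \<otimes>\<^bsub>H\<^esub> q2))))))"]; insert m n, (assumption | rule multilinear_pair)+)
  also have "\<dots> = lsum T M ?X (\<lambda>x m0. rsum T M m0 (\<lambda>m1 p. lsum T N ?Y (\<lambda>y n0.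
      dsum T x (\<lambda>x1 x2. rsum T N (x2 \<triangleright>\<^bsub>N\<^esub> n0) (\<lambda>n1 q. dsum T q (\<lambda>q1 q2.
        pt ((x1 \<otimes>\<^bsub>H\<^esub> y) \<triangleright>\<^bsub>M\<^esub> (m1 \<triangleleft>\<^bsub>M\<^esub> q1)) (n1 \<triangleleft>\<^bsub>N\<^esub> (p \<otimes>\<^bsub>H\<^esub> q2))))))))"
  proof -
    have *: "rsum T N n0 (\<lambda>n1 q. dsum T x (\<lambda>x1 x2. dsum T q (\<lambda>q1 q2.
        pt ((x1 \<otimes>\<^bsub>H\<^esub> y) \<triangleright>\<^bsub>M\<^esub> (m1 \<triangleleft>\<^bsub>M\<^esub> q1))
          ((x2 \<triangleright>\<^bsub>N\<^esub> n1) \<triangleleft>\<^bsub>N\<^esub> (p \<otimes>\<^bsub>H\<^esub> q2))))) =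
      dsum T x (\<lambda>x1 x2. rsum T N (x2 \<triangleright>\<^bsub>N\<^esub> n0) (\<lambda>n1 q. dsum T q (\<lambda>q1 q2.
        pt ((x1 \<otimes>\<^bsub>H\<^esub> y) \<triangleright>\<^bsub>M\<^esub> (m1 \<triangleleft>\<^bsub>M\<^esub> q1)) (n1 \<triangleleft>\<^bsub>N\<^esub> (p \<otimes>\<^bsub>H\<^esub> q2)))))"
      if that: "x \<in> carrier H" "y \<in> carrier H" "p \<in> carrier H" "m1 \<in> carrier M" "n0 \<in> carrier N"
      for x y p m1 n0
    proof -
      have "rsum T N n0 (\<lambda>n1 q. dsum T x (\<lambda>x1 x2. dsum T q (\<lambda>q1 q2.
          pt ((x1 \<otimes>\<^bsub>H\<^esub> y) \<triangleright>\<^bsub>M\<^esub> (m1 \<triangleleft>\<^bsub>M\<^esub> q1))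
            ((x2 \<triangleright>\<^bsub>N\<^esub> n1) \<triangleleft>\<^bsub>N\<^esub> (p \<otimes>\<^bsub>H\<^esub> q2))))) =
        dsum T x (\<lambda>x1 x2. rsum T N n0 (\<lambda>n1 q. dsum T q (\<lambda>q1 q2.
          pt ((x1 \<otimes>\<^bsub>H\<^esub> y) \<triangleright>\<^bsub>M\<^esub> (m1 \<triangleleft>\<^bsub>M\<^esub> q1))
            ((x2 \<triangleright>\<^bsub>N\<^esub> n1) \<triangleleft>\<^bsub>N\<^esub> (p \<otimes>\<^bsub>H\<^esub> q2)))))"
        by (insert that, (assumption | rule sweedler_commute multilinear_pair)+)
      also have "\<dots> = dsum T x (\<lambda>x1 x2. rsum T N (x2 \<triangleright>\<^bsub>N\<^esub> n0) (\<lambda>n1 q. dsum T q (\<lambda>q1 q2.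
          pt ((x1 \<otimes>\<^bsub>H\<^esub> y) \<triangleright>\<^bsub>M\<^esub> (m1 \<triangleleft>\<^bsub>M\<^esub> q1)) (n1 \<triangleleft>\<^bsub>N\<^esub> (p \<otimes>\<^bsub>H\<^esub> q2)))))"
        by (rule sweedler_cong, (insert that,
          (assumption | rule N.rsum_lact[symmetric] multilinear_pair)+))
      finally show ?thesis .
    qed
    show ?thesis by (insert X Y, (assumption | rule * sweedler_cong multilinear_pair)+)
  qed
  also have "\<dots> = lsum T M ?X (\<lambda>x m0. rsum T M m0 (\<lambda>m1 p. dsum T x (\<lambda>x1 x2. lsum T N ?Y (\<lambda>y n0.
      rsum T N (x2 \<triangleright>\<^bsub>N\<^esub> n0) (\<lambda>n1 q. dsum T q (\<lambda>q1 q2.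
        pt ((x1 \<otimes>\<^bsub>H\<^esub> y) \<triangleright>\<^bsub>M\<^esub> (m1 \<triangleleft>\<^bsub>M\<^esub> q1)) (n1 \<triangleleft>\<^bsub>N\<^esub> (p \<otimes>\<^bsub>H\<^esub> q2))))))))"
    by (insert X Y, (assumption | rule sweedler_reorder multilinear_pair)+)
  \<comment> \<open>compatibility of the left action and the left coaction of \<open>N\<close>, for the element \<open>x\<close>\<close>
  also have "\<dots> = lsum T M ?X (\<lambda>x m0. rsum T M m0 (\<lambda>m1 p. dsum T x (\<lambda>x1 x2.
      lsum T N (x1 \<triangleright>\<^bsub>N\<^esub> ?Y) (\<lambda>y n0. rsum T N n0 (\<lambda>n1 q. dsum T q (\<lambda>q1 q2.
        pt ((y \<otimes>\<^bsub>H\<^esub> x2) \<triangleright>\<^bsub>M\<^esub> (m1 \<triangleleft>\<^bsub>M\<^esub> q1)) (n1 \<triangleleft>\<^bsub>N\<^esub> (p \<otimes>\<^bsub>H\<^esub> q2))))))))"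
  proof -
    have *: "dsum T x (\<lambda>x1 x2. lsum T N ?Y (\<lambda>y n0.
      rsum T N (x2 \<triangleright>\<^bsub>N\<^esub> n0) (\<lambda>n1 q. dsum T q (\<lambda>q1 q2.
        pt ((x1 \<otimes>\<^bsub>H\<^esub> y) \<triangleright>\<^bsub>M\<^esub> (m1 \<triangleleft>\<^bsub>M\<^esub> q1)) (n1 \<triangleleft>\<^bsub>N\<^esub> (p \<otimes>\<^bsub>H\<^esub> q2)))))) =
      dsum T x (\<lambda>x1 x2. lsum T N (x1 \<triangleright>\<^bsub>N\<^esub> ?Y) (\<lambda>y n0. rsum T N n0 (\<lambda>n1 q. dsum T q (\<lambda>q1 q2.
        pt ((y \<otimes>\<^bsub>H\<^esub> x2) \<triangleright>\<^bsub>M\<^esub> (m1 \<triangleleft>\<^bsub>M\<^esub> q1)) (n1 \<triangleleft>\<^bsub>N\<^esub> (p \<otimes>\<^bsub>H\<^esub> q2))))))"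
      if that: "x \<in> carrier H" "p \<in> carrier H" "m1 \<in> carrier M" for x p m1
      by (rule N.lsum_lact[where b="\<lambda>a n0. rsum T N n0 (\<lambda>n1 q. dsum T q (\<lambda>q1 q2.
        pt (a \<triangleright>\<^bsub>M\<^esub> (m1 \<triangleleft>\<^bsub>M\<^esub> q1)) (n1 \<triangleleft>\<^bsub>N\<^esub> (p \<otimes>\<^bsub>H\<^esub> q2))))", symmetric];
        insert that Y, (assumption | rule multilinear_pair)+)
    show ?thesis by (insert X Y, (assumption | rule * sweedler_cong multilinear_pair)+)
  qed
  also have "\<dots> = lsum T M ?X (\<lambda>x m0. dsum T x (\<lambda>x1 x2. rsum T M m0 (\<lambda>m1 p.
      lsum T N (x1 \<triangleright>\<^bsub>N\<^esub> ?Y) (\<lambda>y n0. rsum T N n0 (\<lambda>n1 q. dsum T q (\<lambda>q1 q2.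
        pt ((y \<otimes>\<^bsub>H\<^esub> x2) \<triangleright>\<^bsub>M\<^esub> (m1 \<triangleleft>\<^bsub>M\<^esub> q1)) (n1 \<triangleleft>\<^bsub>N\<^esub> (p \<otimes>\<^bsub>H\<^esub> q2))))))))"
    by (insert X Y, (assumption | rule sweedler_reorder multilinear_pair)+)
  also have "\<dots> = lsum T M ?X (\<lambda>x m0. dsum T x (\<lambda>x1 x2. lsum T N (x1 \<triangleright>\<^bsub>N\<^esub> ?Y) (\<lambda>y n0.
      rsum T M m0 (\<lambda>m1 p. rsum T N n0 (\<lambda>n1 q. dsum T q (\<lambda>q1 q2.
        pt ((y \<otimes>\<^bsub>H\<^esub> x2) \<triangleright>\<^bsub>M\<^esub> (m1 \<triangleleft>\<^bsub>M\<^esub> q1)) (n1 \<triangleleft>\<^bsub>N\<^esub> (p \<otimes>\<^bsub>H\<^esub> q2))))))))"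
    by (insert X Y, (assumption | rule sweedler_reorder multilinear_pair)+)
  also have "\<dots> = lsum T M ?X (\<lambda>x m0. dsum T x (\<lambda>x1 x2. lsum T N (x1 \<triangleright>\<^bsub>N\<^esub> ?Y) (\<lambda>y n0.
      rsum T N n0 (\<lambda>n1 q. rsum T M m0 (\<lambda>m1 p. dsum T q (\<lambda>q1 q2.
        pt ((y \<otimes>\<^bsub>H\<^esub> x2) \<triangleright>\<^bsub>M\<^esub> (m1 \<triangleleft>\<^bsub>M\<^esub> q1)) (n1 \<triangleleft>\<^bsub>N\<^esub> (p \<otimes>\<^bsub>H\<^esub> q2))))))))"
    by (insert X Y, (assumption | rule sweedler_reorder multilinear_pair)+)
  \<comment> \<open>compatibility of the right action and the right coaction of \<open>M\<close>, for the element \<open>q\<close>;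
    then \<open>x2\<close> is moved into the argument of the right coaction\<close>
  also have "\<dots> = lsum T M ?X (\<lambda>x m0. dsum T x (\<lambda>x1 x2. lsum T N (x1 \<triangleright>\<^bsub>N\<^esub> ?Y) (\<lambda>y n0.
      rsum T N n0 (\<lambda>n1 q. dsum T q (\<lambda>q1 q2. rsum T M ((x2 \<triangleright>\<^bsub>M\<^esub> m0) \<triangleleft>\<^bsub>M\<^esub> q2) (\<lambda>m1 p.
        pt (y \<triangleright>\<^bsub>M\<^esub> m1) ((n1 \<triangleleft>\<^bsub>N\<^esub> q1) \<triangleleft>\<^bsub>N\<^esub> p)))))))"
  proof -
    have *: "rsum T M m0 (\<lambda>m1 p. dsum T q (\<lambda>q1 q2.
        pt ((y \<otimes>\<^bsub>H\<^esub> x2) \<triangleright>\<^bsub>M\<^esub> (m1 \<triangleleft>\<^bsub>M\<^esub> q1)) (n1 \<triangleleft>\<^bsub>N\<^esub> (p \<otimes>\<^bsub>H\<^esub> q2)))) =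
      dsum T q (\<lambda>q1 q2. rsum T M ((x2 \<triangleright>\<^bsub>M\<^esub> m0) \<triangleleft>\<^bsub>M\<^esub> q2) (\<lambda>m1 p.
        pt (y \<triangleright>\<^bsub>M\<^esub> m1) ((n1 \<triangleleft>\<^bsub>N\<^esub> q1) \<triangleleft>\<^bsub>N\<^esub> p)))"
      if that: "x2 \<in> carrier H" "y \<in> carrier H" "q \<in> carrier H" "m0 \<in> carrier M" "n1 \<in> carrier N"
      for x2 y q m0 n1
    proof -
      have "rsum T M m0 (\<lambda>m1 p. dsum T q (\<lambda>q1 q2.
          pt ((y \<otimes>\<^bsub>H\<^esub> x2) \<triangleright>\<^bsub>M\<^esub> (m1 \<triangleleft>\<^bsub>M\<^esub> q1)) (n1 \<triangleleft>\<^bsub>N\<^esub> (p \<otimes>\<^bsub>H\<^esub> q2)))) =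
        dsum T q (\<lambda>q1 q2. rsum T M m0 (\<lambda>m1 p.
          pt ((y \<otimes>\<^bsub>H\<^esub> x2) \<triangleright>\<^bsub>M\<^esub> (m1 \<triangleleft>\<^bsub>M\<^esub> q1)) (n1 \<triangleleft>\<^bsub>N\<^esub> (p \<otimes>\<^bsub>H\<^esub> q2))))"
        by (insert that, (assumption | rule sweedler_commute multilinear_pair)+)
      also have "\<dots> = dsum T q (\<lambda>q1 q2. rsum T M (m0 \<triangleleft>\<^bsub>M\<^esub> q2) (\<lambda>m1 p.
          pt ((y \<otimes>\<^bsub>H\<^esub> x2) \<triangleright>\<^bsub>M\<^esub> m1) (n1 \<triangleleft>\<^bsub>N\<^esub> (q1 \<otimes>\<^bsub>H\<^esub> p))))"
        by (rule M.rsum_ract[where b="\<lambda>m1 p. pt ((y \<otimes>\<^bsub>H\<^esub> x2) \<triangleright>\<^bsub>M\<^esub> m1) (n1 \<triangleleft>\<^bsub>N\<^esub> p)", symmetric];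
          insert that, (assumption | rule multilinear_pair)+)
      also have "\<dots> = dsum T q (\<lambda>q1 q2. rsum T M (m0 \<triangleleft>\<^bsub>M\<^esub> q2) (\<lambda>m1 p.
          pt (y \<triangleright>\<^bsub>M\<^esub> (x2 \<triangleright>\<^bsub>M\<^esub> m1)) ((n1 \<triangleleft>\<^bsub>N\<^esub> q1) \<triangleleft>\<^bsub>N\<^esub> p)))"
        by (insert that,
          (assumption | rule arg_cong2[where f=pt] M.lact_mult N.ract_mult sweedler_cong multilinear_pair)+)
      also have "\<dots> = dsum T q (\<lambda>q1 q2. rsum T M (x2 \<triangleright>\<^bsub>M\<^esub> (m0 \<triangleleft>\<^bsub>M\<^esub> q2)) (\<lambda>m1 p.
          pt (y \<triangleright>\<^bsub>M\<^esub> m1) ((n1 \<triangleleft>\<^bsub>N\<^esub> q1) \<triangleleft>\<^bsub>N\<^esub> p)))"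
        by (rule sweedler_cong, (insert that,
          (assumption | rule M.rsum_lact[symmetric] multilinear_pair)+))
      also have "\<dots> = dsum T q (\<lambda>q1 q2. rsum T M ((x2 \<triangleright>\<^bsub>M\<^esub> m0) \<triangleleft>\<^bsub>M\<^esub> q2) (\<lambda>m1 p.
          pt (y \<triangleright>\<^bsub>M\<^esub> m1) ((n1 \<triangleleft>\<^bsub>N\<^esub> q1) \<triangleleft>\<^bsub>N\<^esub> p)))"
        by (rule sweedler_cong, (insert that, (assumption | rule
          arg_cong[where f="\<lambda>z. rsum T M z _"] M.lact_ract[symmetric] multilinear_pair)+))
      finally show ?thesis .
    qed
    show ?thesis by (insert X Y, (assumption | rule * sweedler_cong multilinear_pair)+)
  qed
  \<comment> \<open>\<open>x2\<close> acts from the left on \<open>m0\<close>: absorb it, which undoes \<open>rtwist m\<close>\<close>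
  also have "\<dots> = lsum T M (M.ltwist ?X) (\<lambda>x m0. lsum T N (x \<triangleright>\<^bsub>N\<^esub> ?Y) (\<lambda>y n0.
      rsum T N n0 (\<lambda>n1 q. dsum T q (\<lambda>q1 q2. rsum T M (m0 \<triangleleft>\<^bsub>M\<^esub> q2) (\<lambda>m1 p.
        pt (y \<triangleright>\<^bsub>M\<^esub> m1) ((n1 \<triangleleft>\<^bsub>N\<^esub> q1) \<triangleleft>\<^bsub>N\<^esub> p))))))"
    by (rule M.lsum_absorb[where b="\<lambda>x m0. lsum T N (x \<triangleright>\<^bsub>N\<^esub> ?Y) (\<lambda>y n0.
      rsum T N n0 (\<lambda>n1 q. dsum T q (\<lambda>q1 q2. rsum T M (m0 \<triangleleft>\<^bsub>M\<^esub> q2) (\<lambda>m1 p.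
        pt (y \<triangleright>\<^bsub>M\<^esub> m1) ((n1 \<triangleleft>\<^bsub>N\<^esub> q1) \<triangleleft>\<^bsub>N\<^esub> p)))))"]; insert X Y, (assumption | rule multilinear_pair)+)
  also have "M.ltwist ?X = m" by (rule M.ltwist_rtwist[OF m])
  \<comment> \<open>\<open>q1\<close> acts from the right on \<open>n1\<close>: absorb it, which undoes \<open>ltwist n\<close>\<close>
  also have "lsum T M m (\<lambda>x m0. lsum T N (x \<triangleright>\<^bsub>N\<^esub> ?Y) (\<lambda>y n0.
      rsum T N n0 (\<lambda>n1 q. dsum T q (\<lambda>q1 q2. rsum T M (m0 \<triangleleft>\<^bsub>M\<^esub> q2) (\<lambda>m1 p.
        pt (y \<triangleright>\<^bsub>M\<^esub> m1) ((n1 \<triangleleft>\<^bsub>N\<^esub> q1) \<triangleleft>\<^bsub>N\<^esub> p)))))) = ?V"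
  proof -
    have *: "lsum T N (x \<triangleright>\<^bsub>N\<^esub> ?Y) (\<lambda>y n0.
        rsum T N n0 (\<lambda>n1 q. dsum T q (\<lambda>q1 q2. rsum T M (m0 \<triangleleft>\<^bsub>M\<^esub> q2) (\<lambda>m1 p.
          pt (y \<triangleright>\<^bsub>M\<^esub> m1) ((n1 \<triangleleft>\<^bsub>N\<^esub> q1) \<triangleleft>\<^bsub>N\<^esub> p))))) =
      lsum T N (x \<triangleright>\<^bsub>N\<^esub> n) (\<lambda>y n0. rsum T N n0 (\<lambda>n1 q.
        rsum T M (m0 \<triangleleft>\<^bsub>M\<^esub> q) (\<lambda>m1 p. pt (y \<triangleright>\<^bsub>M\<^esub> m1) (n1 \<triangleleft>\<^bsub>N\<^esub> p))))"
      if that: "x \<in> carrier H" "m0 \<in> carrier M" for x m0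
    proof -
      have "lsum T N (x \<triangleright>\<^bsub>N\<^esub> ?Y) (\<lambda>y n0.
        rsum T N n0 (\<lambda>n1 q. dsum T q (\<lambda>q1 q2. rsum T M (m0 \<triangleleft>\<^bsub>M\<^esub> q2) (\<lambda>m1 p.
          pt (y \<triangleright>\<^bsub>M\<^esub> m1) ((n1 \<triangleleft>\<^bsub>N\<^esub> q1) \<triangleleft>\<^bsub>N\<^esub> p))))) =
        lsum T N (N.rtwist (x \<triangleright>\<^bsub>N\<^esub> ?Y)) (\<lambda>y n0. rsum T N n0 (\<lambda>n1 q.
          rsum T M (m0 \<triangleleft>\<^bsub>M\<^esub> q) (\<lambda>m1 p. pt (y \<triangleright>\<^bsub>M\<^esub> m1) (n1 \<triangleleft>\<^bsub>N\<^esub> p))))"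
        by (rule N.lsum_rsum_absorb_right[where c="\<lambda>y n1 q.
          rsum T M (m0 \<triangleleft>\<^bsub>M\<^esub> q) (\<lambda>m1 p. pt (y \<triangleright>\<^bsub>M\<^esub> m1) (n1 \<triangleleft>\<^bsub>N\<^esub> p))"];
          insert that Y, (assumption | rule multilinear_pair)+)
      then show ?thesis using that n Y by (simp add: N.rtwist_lact N.rtwist_ltwist)
    qed
    show ?thesis by (insert m n, (assumption | rule * sweedler_cong multilinear_pair)+)
  qed
  finally show ?thesis .
qed

end

text \<open>
  Of its target, a Sweedler sum uses only the carrier, addition, zero and scalar multiplication.
\<close>

lemma sweedler_ydl_tensor:
  "sweedler K (ydl_tensor K H M N) t b = sweedler K (M \<boxtimes>\<^bsub>K\<^esub> N) t b"
  by (simp add: sweedler_def Let_def finsum_def finprod_def ydl_tensor_def)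

context u_pair begin

text \<open>The tensor product \<open>T\<close> with its actions and coactions.\<close>

abbreviation "MN \<equiv> ydl_tensor K H M N"

lemma lcoact_tensor_ptensor:
  assumes m: "m \<in> carrier M" and n: "n \<in> carrier N"
  shows "lcoact MN (pt m n) = lsum (H \<boxtimes> T) M m (\<lambda>x m0. lsum (H \<boxtimes> T) N n (\<lambda>y n0.
    ptensor K H T (x \<otimes>\<^bsub>H\<^esub> y) (pt m0 n0)))"
  unfolding ydl_tensor_def Let_def ydl.simps
  by (rule sweedler_ptensor; insert m n, (assumption | rule multilinear_pair)+)

lemma rcoact_tensor_ptensor:
  assumes m: "m \<in> carrier M" and n: "n \<in> carrier N"
  shows "rcoact MN (pt m n) = rsum (T \<boxtimes> H) M m (\<lambda>m0 x. rsum (T \<boxtimes> H) N n (\<lambda>n0 y.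
    ptensor K T H (pt m0 n0) (x \<otimes>\<^bsub>H\<^esub> y)))"
  unfolding ydl_tensor_def Let_def ydl.simps
  by (rule sweedler_ptensor; insert m n, (assumption | rule multilinear_pair)+)

lemma lact_tensor_ptensor:
  assumes h: "h \<in> carrier H" and m: "m \<in> carrier M" and n: "n \<in> carrier N"
  shows "h \<triangleright>\<^bsub>MN\<^esub> pt m n = dsum T h (\<lambda>h1 h2. pt (h1 \<triangleright>\<^bsub>M\<^esub> m) (h2 \<triangleright>\<^bsub>N\<^esub> n))"
  unfolding ydl_tensor_def Let_def ydl.simps
  by (rule sweedler_cong, (insert h m n, (assumption | rule sweedler_ptensor multilinear_pair)+))

lemma ract_tensor_ptensor:
  assumes h: "h \<in> carrier H" and m: "m \<in> carrier M" and n: "n \<in> carrier N"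
  shows "pt m n \<triangleleft>\<^bsub>MN\<^esub> h = dsum T h (\<lambda>h1 h2. pt (m \<triangleleft>\<^bsub>M\<^esub> h1) (n \<triangleleft>\<^bsub>N\<^esub> h2))"
  unfolding ydl_tensor_def Let_def ydl.simps
  by (rule sweedler_cong, (insert h m n, (assumption | rule sweedler_ptensor multilinear_pair)+))

lemma linear_lcoact_tensor: "linear_map K T (H \<boxtimes> T) (lcoact MN)"
  unfolding ydl_tensor_def Let_def ydl.simps by (assumption | rule multilinear_pair)+

lemma linear_rcoact_tensor: "linear_map K T (T \<boxtimes> H) (rcoact MN)"
  unfolding ydl_tensor_def Let_def ydl.simps by (assumption | rule multilinear_pair)+

lemma bilinear_lact_tensor: "bilinear_map K H T T (lact MN)"
  unfolding ydl_tensor_def Let_def ydl.simps by (assumption | rule multilinear_pair)+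

lemma bilinear_ract_tensor: "bilinear_map K T H T (ract MN)"
  unfolding ydl_tensor_def Let_def ydl.simps by (assumption | rule multilinear_pair)+

lemmas multilinear_tensor = multilinear_pair
  bilinear_map_comp[OF bilinear_lact_tensor] bilinear_map_closed[OF bilinear_lact_tensor]
  bilinear_map_comp[OF bilinear_ract_tensor] bilinear_map_closed[OF bilinear_ract_tensor]
  linear_map_comp[OF linear_lcoact_tensor] linear_map_closed[OF linear_lcoact_tensor]
  linear_map_comp[OF linear_rcoact_tensor] linear_map_closed[OF linear_rcoact_tensor]

lemma u_map_ptensor:
  assumes m: "m \<in> carrier M" and n: "n \<in> carrier N"
  shows "lsum T MN (pt m n) (\<lambda>x t0. rsum T MN t0 (\<lambda>t1 y. (x \<triangleright>\<^bsub>MN\<^esub> t1) \<triangleleft>\<^bsub>MN\<^esub> y)) =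
    lsum T M m (\<lambda>x m0. lsum T N n (\<lambda>y n0. rsum T M m0 (\<lambda>m1 p. rsum T N n0 (\<lambda>n1 q.
      dsum T (x \<otimes>\<^bsub>H\<^esub> y) (\<lambda>h1 h2. dsum T (p \<otimes>\<^bsub>H\<^esub> q) (\<lambda>k1 k2.
        pt ((h1 \<triangleright>\<^bsub>M\<^esub> m1) \<triangleleft>\<^bsub>M\<^esub> k1) ((h2 \<triangleright>\<^bsub>N\<^esub> n1) \<triangleleft>\<^bsub>N\<^esub> k2)))))))"
proof -
  have act: "(h \<triangleright>\<^bsub>MN\<^esub> pt m1 n1) \<triangleleft>\<^bsub>MN\<^esub> k = dsum T h (\<lambda>h1 h2. dsum T k (\<lambda>k1 k2.
        pt ((h1 \<triangleright>\<^bsub>M\<^esub> m1) \<triangleleft>\<^bsub>M\<^esub> k1) ((h2 \<triangleright>\<^bsub>N\<^esub> n1) \<triangleleft>\<^bsub>N\<^esub> k2)))"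
    if "h \<in> carrier H" "k \<in> carrier H" "m1 \<in> carrier M" "n1 \<in> carrier N" for h k m1 n1
  proof -
    have lin: "linear_map K T T (\<lambda>t. t \<triangleleft>\<^bsub>MN\<^esub> k)" by (insert that, (assumption | rule multilinear_tensor)+)
    show ?thesis unfolding lact_tensor_ptensor[OF that(1,3,4)]
      by (insert that,
        (assumption | rule apply_sweedler_eq[OF lin] ract_tensor_ptensor multilinear_tensor)+)
  qed
  have R: "rsum T MN (pt m0 n0) (\<lambda>t1 y. (h \<triangleright>\<^bsub>MN\<^esub> t1) \<triangleleft>\<^bsub>MN\<^esub> y) =
      rsum T M m0 (\<lambda>m1 p. rsum T N n0 (\<lambda>n1 q. dsum T h (\<lambda>h1 h2. dsum T (p \<otimes>\<^bsub>H\<^esub> q) (\<lambda>k1 k2.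
        pt ((h1 \<triangleright>\<^bsub>M\<^esub> m1) \<triangleleft>\<^bsub>M\<^esub> k1) ((h2 \<triangleright>\<^bsub>N\<^esub> n1) \<triangleleft>\<^bsub>N\<^esub> k2)))))"
    if "h \<in> carrier H" "m0 \<in> carrier M" "n0 \<in> carrier N" for h m0 n0
  proof -
    let ?b = "\<lambda>t1 y. (h \<triangleright>\<^bsub>MN\<^esub> t1) \<triangleleft>\<^bsub>MN\<^esub> y"
    have b: "bilinear_map K T H T ?b" by (insert that, (assumption | rule multilinear_tensor)+)
    have lin: "linear_map K (T \<boxtimes> H) T (\<lambda>s. sweedler K T s ?b)"
      by (insert b, (assumption | rule multilinear_tensor)+)
    have *: "sweedler K T (ptensor K T H (pt m1 n1) k) ?b = dsum T h (\<lambda>h1 h2. dsum T k (\<lambda>k1 k2.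
        pt ((h1 \<triangleright>\<^bsub>M\<^esub> m1) \<triangleleft>\<^bsub>M\<^esub> k1) ((h2 \<triangleright>\<^bsub>N\<^esub> n1) \<triangleleft>\<^bsub>N\<^esub> k2)))"
      if "k \<in> carrier H" "m1 \<in> carrier M" "n1 \<in> carrier N" for k m1 n1
      by (rule trans[OF sweedler_ptensor[OF b] act]; insert that \<open>h \<in> carrier H\<close>,
        (assumption | rule multilinear_tensor)+)
    show ?thesis unfolding rcoact_tensor_ptensor[OF that(2,3)]
      by (insert that, (assumption | rule apply_sweedler_eq[OF lin] * multilinear_tensor)+)
  qed
  let ?b = "\<lambda>x t0. rsum T MN t0 (\<lambda>t1 y. (x \<triangleright>\<^bsub>MN\<^esub> t1) \<triangleleft>\<^bsub>MN\<^esub> y)"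
  have b: "bilinear_map K H T T ?b" by (assumption | rule multilinear_tensor)+
  have lin: "linear_map K (H \<boxtimes> T) T (\<lambda>s. sweedler K T s ?b)"
    by (insert b, (assumption | rule multilinear_tensor)+)
  have *: "sweedler K T (ptensor K H T h (pt m0 n0)) ?b =
      rsum T M m0 (\<lambda>m1 p. rsum T N n0 (\<lambda>n1 q. dsum T h (\<lambda>h1 h2. dsum T (p \<otimes>\<^bsub>H\<^esub> q) (\<lambda>k1 k2.
        pt ((h1 \<triangleright>\<^bsub>M\<^esub> m1) \<triangleleft>\<^bsub>M\<^esub> k1) ((h2 \<triangleright>\<^bsub>N\<^esub> n1) \<triangleleft>\<^bsub>N\<^esub> k2)))))"
    if "h \<in> carrier H" "m0 \<in> carrier M" "n0 \<in> carrier N" for h m0 n0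
    by (rule trans[OF sweedler_ptensor[OF b] R]; insert that,
      (assumption | rule multilinear_tensor)+)
  show ?thesis unfolding lcoact_tensor_ptensor[OF m n]
    by (insert m n, (assumption | rule apply_sweedler_eq[OF lin] * multilinear_tensor)+)
qed

lemma linear_braiding: "linear_map K T (N \<boxtimes> M) (braiding K M N)"
  unfolding braiding_def[abs_def] by (assumption | rule multilinear_pair)+

lemma linear_braiding_swapped: "linear_map K (N \<boxtimes> M) T (braiding K N M)"
  unfolding braiding_def[abs_def] by (assumption | rule multilinear_pair)+

theorem u_map_eq_braiding_braiding:
  assumes t: "t \<in> carrier T"
  shows "lsum T MN t (\<lambda>x t0. rsum T MN t0 (\<lambda>t1 y. (x \<triangleright>\<^bsub>MN\<^esub> t1) \<triangleleft>\<^bsub>MN\<^esub> y)) =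
    braiding K N M (braiding K M N t)"
proof (rule tensor_linear_ext[OF _ _ _ t])
  show "linear_map K T T (\<lambda>t. lsum T MN t (\<lambda>x t0. rsum T MN t0 (\<lambda>t1 y. (x \<triangleright>\<^bsub>MN\<^esub> t1) \<triangleleft>\<^bsub>MN\<^esub> y)))"
    by (assumption | rule multilinear_tensor)+
  show "linear_map K T T (\<lambda>t. braiding K N M (braiding K M N t))"
    by (rule linear_map_comp[OF linear_braiding_swapped linear_braiding])
qed (simp_all add: u_map_ptensor u_expression_eq_braidings braiding_braiding_ptensor, (rule multilinear_pair)+)

lemma u_condition_tensor_iff:
  "u_condition K MN \<longleftrightarrow> (\<forall>t \<in> carrier T. braiding K N M (braiding K M N t) = t)"
proof -
  have "carrier MN = carrier T" by (simp add: ydl_tensor_def Let_def)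
  then show ?thesis
    by (simp add: u_condition_def sweedler_ydl_tensor u_map_eq_braiding_braiding)
qed

end

theorem proposition4p3:
  fixes K :: "('k, 'c) ring_scheme"
    and H :: "('k, 'h, 'z) hopf_scheme"
    and M :: "('k, 'h, 'm, 'x) ydl_scheme"
    and N :: "('k, 'h, 'n, 'y) ydl_scheme"
  assumes "hopf_algebra K H"
    and "\<forall>h \<in> carrier H. antipode H (antipode H h) = h"
    and "yd_long_bimodule K H M"
    and "yd_long_bimodule K H N"
    and "u_condition K M"
    and "u_condition K N"
  shows "u_condition K (ydl_tensor K H M N) \<longleftrightarrow>
    (\<forall>t \<in> carrier (M \<boxtimes>\<^bsub>K\<^esub> N). braiding K N M (braiding K M N t) = t)"
proof -
  interpret u_pair K H M N
    using assms by (intro u_pair.intro u_bimodule.intro u_bimodule_axioms.intro)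
  show ?thesis by (rule u_condition_tensor_iff)
qed

end
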